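(* For $m\ge1$, the $m$-dimensional permutohedron $Q(\Delta_1,m+1)$ is a generalized $\pi$-twisted Cayley sum over $m\Delta_1$ of $m+1$ polytopes $R_1,\ldots,R_{m+1}$ normally equivalent to $Q(\Delta_1,m)$ such that $\{\pi(R_1),\ldots,\pi(R_{m+1})\}=m\Delta_1\cap\mathbb{Z}$. Here $\pi\colon M\to\mathbb{Z}$ is a surjective map of lattices, where $M$ is the character lattice in whose realification $Q(\Delta_1,m+1)$ lives.
   Context: $\Delta_1$ is the $1$-dimensional lattice simplex (a unit segment), with toric variety $\mathbb{P}^1$, and $m\Delta_1$ is its $m$-th dilate, which contains $m+1$ lattice points. The polytope $Q(\Delta_1,n)$, $n\ge1$: let $H\subseteq\mathbb{P}^1$ be the dense torus, diagonally embedded in $(\mathbb{P}^1)^n$. The Chow quotient $(\mathbb{P}^1)^n/\!/H$ is the Zariski closure, in the Chow variety of $(\mathbb{P}^1)^n$, of the set of points corresponding to the orbit closures $\overline{H\cdot x}$ (with reduced structure) for $x\in H^n$. Its normalization is the projective toric variety of the quotient fan $\mathcal{Q}(\Delta_1,n)$ in $\mathbb{R}^n/\mathbb{R}$ (quotient by the diagonal), which is the common refinement of the images under $\mathbb{R}^n\to\mathbb{R}^n/\mathbb{R}$ of the cones of $\Sigma^n$, where $\Sigma=\{\{0\},\mathbb{R}_{\ge0},\mathbb{R}_{\le0}\}$. $Q(\Delta_1,n)$ denotes the lattice polytope with normal fan $\mathcal{Q}(\Delta_1,n)$ corresponding to the (linearized) ample polarization induced on this toric variety by the projective Chow quotient $(\mathbb{P}^1)^n/\!/H$.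 It is the fiber polytope associated to the fibration $\Delta_1^n\to n\Delta_1$, $(x_1,\ldots,x_n)\mapsto x_1+\cdots+x_n$, and is the $(n-1)$-dimensional permutohedron. Two polytopes $A,B$ of the same dimension are strictly combinatorially isomorphic if there is a bijective inclusion-preserving map $\varphi$ from the faces of $A$ to the faces of $B$ such that the affine hulls of $G$ and $\varphi(G)$ are translates of each other for every face $G$ of $A$; under this assumption they are normally equivalent if moreover their inner normal fans coincide. To compare $Q(\Delta_1,m)$ with the $R_i$, the lattice in whose realification $Q(\Delta_1,m)$ lives is identified with $\ker\pi$. Generalized $\pi$-twisted Cayley sum: let $\pi\colon M\to\Lambda$ be a surjective map of lattices with linear extension $\pi_{\mathbb{R}}\colon M_{\mathbb{R}}\to\Lambda_{\mathbb{R}}$ (also written $\pi$), and let $R_1,\ldots,R_k\subseteq M_{\mathbb{R}}$ be normally equivalent lattice polytopes such that each $\pi_{\mathbb{R}}(R_i)=v_i$ is a lattice point of $\Lambda$. Put $R=\mathrm{Conv}(R_1,\ldots,R_k)$ and $F=\mathrm{Conv}(v_1,\ldots,v_k)$. Then $\pi_{\mathbb{R}}|_R\colon R\to F$ is called a generalized $\pi$-twisted Cayley sum of $R_1,\ldots,R_k$ (over $F$). *)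

theory Defs
  imports "HOL-Analysis.Analysis"
begin

section \<open>Lattices and lattice polytopes\<close>

text \<open>A lattice is realised as the integral span of a linearly independent set in a Euclidean
  space; its realification is \<open>span M\<close>.\<close>

definition is_lattice :: "'a::euclidean_space set \<Rightarrow> bool" where
  "is_lattice M \<longleftrightarrow>
     (\<exists>B. finite B \<and> independent B \<and> M = {\<Sum>b\<in>B. of_int (c b) *\<^sub>R b | c :: 'a \<Rightarrow> int. True})"

definition lattice_polytope :: "'a::euclidean_space set \<Rightarrow> 'a set \<Rightarrow> bool" where
  "lattice_polytope M P \<longleftrightarrow> (\<exists>V. finite V \<and> V \<noteq> {} \<and> V \<subseteq> M \<and> P = convex hull V)"

text \<open>Maps of lattices are given by linear maps of the ambient spaces; only the restriction
  to \<open>span M\<close>, which is the real-linear extension of \<open>M \<rightarrow> L\<close>, is ever used.\<close>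

definition lattice_surjection ::
    "'a::euclidean_space set \<Rightarrow> 'b::euclidean_space set \<Rightarrow> ('a \<Rightarrow> 'b) \<Rightarrow> bool" where
  "lattice_surjection M L p \<longleftrightarrow> is_lattice M \<and> is_lattice L \<and> linear p \<and> p ` M = L"

definition lattice_isomorphism ::
    "'a::euclidean_space set \<Rightarrow> 'b::euclidean_space set \<Rightarrow> ('a \<Rightarrow> 'b) \<Rightarrow> bool" where
  "lattice_isomorphism M L p \<longleftrightarrow> is_lattice M \<and> is_lattice L \<and> linear p \<and> bij_betw p M L"

section \<open>Normal equivalence\<close>

text \<open>The dual of a linear subspace \<open>V\<close> is identified with \<open>V\<close> by the inner product.\<close>

definition inner_normal_fan :: "'a::euclidean_space set \<Rightarrow> 'a set \<Rightarrow> 'a set set" where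
  "inner_normal_fan V P =
     {{u \<in> V. \<forall>x\<in>F. \<forall>y\<in>P. u \<bullet> x \<le> u \<bullet> y} | F. F face_of P \<and> F \<noteq> {}}"

definition strictly_comb_isomorphic :: "'a::euclidean_space set \<Rightarrow> 'a set \<Rightarrow> bool" where
  "strictly_comb_isomorphic A B \<longleftrightarrow>
     polytope A \<and> polytope B \<and> aff_dim A = aff_dim B \<and>
     (\<exists>\<phi>. bij_betw \<phi> {G. G face_of A} {G. G face_of B} \<and>
          (\<forall>G G'. G face_of A \<and> G' face_of A \<and> G \<subseteq> G' \<longrightarrow> \<phi> G \<subseteq> \<phi> G') \<and>
          (\<forall>G. G face_of A \<longrightarrow> (\<exists>a. affine hull (\<phi> G) = (\<lambda>x. a + x) ` (affine hull G))))"

definition normally_equivalent ::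
    "'a::euclidean_space set \<Rightarrow> 'a set \<Rightarrow> 'a set \<Rightarrow> bool" where
  "normally_equivalent V A B \<longleftrightarrow>
     strictly_comb_isomorphic A B \<and> inner_normal_fan V A = inner_normal_fan V B"

section \<open>Generalized twisted Cayley sums\<close>

definition generalized_twisted_cayley_sum ::
    "'a::euclidean_space set \<Rightarrow> 'b::euclidean_space set \<Rightarrow> ('a \<Rightarrow> 'b) \<Rightarrow>
     nat \<Rightarrow> (nat \<Rightarrow> 'a set) \<Rightarrow> 'a set \<Rightarrow> 'b set \<Rightarrow> bool" where
  "generalized_twisted_cayley_sum M L p k R P F \<longleftrightarrow>
     k \<ge> 1 \<and> lattice_surjection M L p \<and>
     (\<forall>i\<in>{1..k}. lattice_polytope M (R i)) \<and>
     (\<forall>i\<in>{1..k}. \<forall>j\<in>{1..k}. normally_equivalent (span M) (R i) (R j)) \<and>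
     (\<exists>v. (\<forall>i\<in>{1..k}. v i \<in> L \<and> p ` R i = {v i}) \<and> F = convex hull (v ` {1..k})) \<and>
     P = convex hull (\<Union>i\<in>{1..k}. R i)"

section \<open>Fiber polytopes\<close>

text \<open>The fiber polytope of \<open>p : P \<rightarrow> p(P)\<close> (Billera--Sturmfels): the set of integrals of all
  sections. There is no division by the volume of \<open>p(P)\<close>: for the unit cube over a
  segment, it is the unnormalized Minkowski integral that is (up to translation) a lattice
  polytope.\<close>

definition fiber_polytope ::
    "('a::euclidean_space \<Rightarrow> 'b::euclidean_space) \<Rightarrow> 'a set \<Rightarrow> 'a set" where
  "fiber_polytope p P =
     {integral (p ` P) \<gamma> | \<gamma>.
        continuous_on (p ` P) \<gamma> \<and> (\<forall>y\<in>p ` P. \<gamma> y \<in> P \<and> p (\<gamma> y) = y)}"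

section \<open>The Chow quotient polytope of powers of the projective line\<close>

definition Delta1 :: "real set" where
  "Delta1 = convex hull {0, 1}"

definition coord_sum :: "real ^ 'n \<Rightarrow> real" where
  "coord_sum x = (\<Sum>i\<in>UNIV. x $ i)"

text \<open>The character lattice of \<open>H\<^sup>n/H\<close>, dual to \<open>\<int>\<^sup>n/\<int>\<close>.\<close>

definition char_lattice :: "(real ^ 'n) set" where
  "char_lattice = {x. (\<forall>i. x $ i \<in> \<int>) \<and> coord_sum x = 0}"

text \<open>The quotient \<open>\<real>\<^sup>n/\<real>\<close> is represented by the hyperplane of vectors with coordinate sum
  zero; the quotient map becomes the orthogonal projection, which is compatible with the
  pairing used in \<open>inner_normal_fan\<close>.\<close>

definition diag_quotient :: "real ^ 'n \<Rightarrow> real ^ 'n" where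
  "diag_quotient w = (\<chi> i. w $ i - coord_sum w / real CARD('n))"

definition P1_fan :: "real set set" where
  "P1_fan = {{0}, {0..}, {..0}}"

definition P1_power_fan :: "(real ^ 'n) set set" where
  "P1_power_fan = {{w. \<forall>i. w $ i \<in> s i} | s. \<forall>i. s i \<in> P1_fan}"

text \<open>The cone of the common refinement through \<open>w\<close> is the intersection of all
  the cones containing \<open>w\<close>.\<close>

definition common_refinement :: "'a set \<Rightarrow> 'a set set \<Rightarrow> 'a set set" where
  "common_refinement V \<D> = {\<Inter>{D \<in> \<D>. w \<in> D} | w. w \<in> V}"

definition quotient_fan :: "(real ^ 'n) set set" where
  "quotient_fan = common_refinement (range diag_quotient) ((`) diag_quotient ` P1_power_fan)"

text \<open>\<open>Q\<close> is a polytope of the linearized polarization of the Chow quotient of \<open>n = CARD('n)\<close>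
  copies of the projective line. The polarization is the one whose polytope is the fiber
  polytope of \<open>Delta1\<^sup>n \<rightarrow> n Delta1\<close>. The linearization accounts for a translation into the
  realification of the character lattice, so \<open>Q\<close> is determined up to translation by a
  character; in general no translate is preferred over the others.\<close>

definition is_chow_polytope :: "(real ^ 'n) set \<Rightarrow> bool" where
  "is_chow_polytope Q \<longleftrightarrow>
     lattice_polytope char_lattice Q \<and>
     inner_normal_fan (span char_lattice) Q = quotient_fan \<and>
     (\<exists>a. Q = (\<lambda>x. a + x) ` fiber_polytope coord_sum {x. \<forall>i. x $ i \<in> Delta1})"

end

theory Submission
  imports Defs
begin

text \<open>Up to translation, \<open>Q\<close> is the convex hull of the rankings (bijections onto
  \<open>{0, \<dots>, n - 1}\<close>) of the coordinates: minimizing a linear functional over the sections of the cube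
  is a fractional knapsack problem in each fibre, solved by a monotone edge path. If the rank values
  are replaced by any strictly increasing sequence, a functional \<open>u\<close> is still minimized
  exactly at the rankings that are antitone in \<open>u\<close>. Two indexed point families for which every
  functional has the same minimizing indices span normally equivalent polytopes. Cutting \<open>Q\<close> along the
  values of one coordinate gives slices, each of which is such a permutohedron of the remaining
  coordinates whose rank values skip one number.\<close>

section \<open>Polytopes with the same minimizing indices\<close>

text \<open>Comparing face lattices directly would require an explicit description of all faces.
  Indices avoid this: a nonempty face is exposed by a functional in the direction space and is
  spanned by the points at its minimizing indices. So the face lattice, the normal fan and, less
  obviously, the directions of the affine hulls depend only on which index set each functional
  selects. Strict isomorphism asks for those directions, hence the separate span argument. The cones
  of the quotient fan fit the same scheme, because containment between sets of antitone rankings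
  amounts to comparing weak orders. A Chow polytope is fixed only up to translation. The integrals
  of edge paths carry 1/2 in each coordinate, and only the lattice condition, tested at a vertex,
  shows that the total translation is integral. The integer that it leaves at the cutting coordinate
  displaces the base segment from \<open>[0, m]\<close> to \<open>[c, c + m]\<close>.\<close>

definition minimizers :: "'i set \<Rightarrow> ('i \<Rightarrow> real) \<Rightarrow> 'i set" where
  "minimizers I g = {i \<in> I. \<forall>j\<in>I. g i \<le> g j}"

lemma minimizers_subset: "minimizers I g \<subseteq> I"
  by (auto simp: minimizers_def)

lemma minimizers_nonempty:
  assumes "finite I" "I \<noteq> {}"
  shows "minimizers I g \<noteq> {}"
proof -
  have "arg_min_on g I \<in> minimizers I g"
    using arg_min_if_finite[OF assms, of g] by (force simp: minimizers_def not_less)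
  then show ?thesis by blast
qed

text \<open>The minimal points of \<open>u\<close> form the intersection with a supporting
  hyperplane, hence a face. A face of a hull of finitely many points is the hull of some of them,
  and these can only be minimizing ones.\<close>

lemma convex_hull_minimizers:
  fixes v :: "'i \<Rightarrow> 'a::euclidean_space"
  assumes "finite I" "I \<noteq> {}"
  shows "convex hull (v ` minimizers I (\<lambda>i. u \<bullet> v i)) =
    {x \<in> convex hull (v ` I). \<forall>y\<in>convex hull (v ` I). u \<bullet> x \<le> u \<bullet> y}" (is "?L = ?R")
    and "convex hull (v ` minimizers I (\<lambda>i. u \<bullet> v i)) face_of convex hull (v ` I)"
proof -
  obtain i0 where i0: "i0 \<in> minimizers I (\<lambda>i. u \<bullet> v i)"
    using minimizers_nonempty[OF assms] by blast
  define c where "c = u \<bullet> v i0"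
  have "v ` I \<subseteq> {x. u \<bullet> x \<ge> c}"
    using i0 by (auto simp: minimizers_def c_def)
  then have ge: "convex hull (v ` I) \<subseteq> {x. u \<bullet> x \<ge> c}"
    by (simp add: convex_halfspace_ge subset_hull)
  have v0: "v i0 \<in> convex hull (v ` I)"
    using i0 by (auto simp: minimizers_def intro!: hull_inc)
  have R: "?R = convex hull (v ` I) \<inter> {x. u \<bullet> x = c}"
    using ge v0 by (force simp: c_def)
  have F: "?R face_of convex hull (v ` I)"
    unfolding R using ge by (intro face_of_Int_supporting_hyperplane_ge) auto
  then obtain S where S: "S \<subseteq> v ` I" "?R = convex hull S"
    using face_of_convex_hull_subset[of "v ` I" ?R] assms finite_imp_compact by blast
  have "S \<subseteq> ?R" using S(2) hull_subset by metis
  then have "S \<subseteq> v ` minimizers I (\<lambda>i. u \<bullet> v i)"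
    using S(1) by (fastforce simp: minimizers_def hull_inc)
  then have 1: "?R \<subseteq> ?L" unfolding S(2) by (rule hull_mono)
  have "v ` minimizers I (\<lambda>i. u \<bullet> v i) \<subseteq> ?R"
    unfolding R using i0 by (auto simp: minimizers_def c_def intro!: hull_inc antisym)
  then have "?L \<subseteq> ?R"
    using F by (intro hull_minimal) (auto dest: face_of_imp_convex)
  with 1 show eq: "?L = ?R" by blast
  show "?L face_of convex hull (v ` I)" unfolding eq by (rule F)
qed

text \<open>Lets the index set be recovered from the face, even when \<open>v\<close> is not
  injective or some \<open>v i\<close> is not a vertex.\<close>

lemma mem_convex_hull_minimizers_iff:
  fixes v :: "'i \<Rightarrow> 'a::euclidean_space"
  assumes "finite I" "i \<in> I"
  shows "v i \<in> convex hull (v ` minimizers I (\<lambda>i. u \<bullet> v i)) \<longleftrightarrow> i \<in> minimizers I (\<lambda>i. u \<bullet> v i)"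
proof
  assume "v i \<in> convex hull (v ` minimizers I (\<lambda>i. u \<bullet> v i))"
  moreover have "I \<noteq> {}" using assms by blast
  ultimately show "i \<in> minimizers I (\<lambda>i. u \<bullet> v i)"
    using convex_hull_minimizers(1)[OF assms(1), of v u] assms(2)
    by (auto simp: minimizers_def hull_inc)
qed (simp add: hull_inc)

lemma face_of_convex_hull_minimizers:
  fixes v :: "'i \<Rightarrow> 'a::euclidean_space"
  assumes I: "finite I" "I \<noteq> {}" and V: "subspace V"
    and d: "\<And>i j. i \<in> I \<Longrightarrow> j \<in> I \<Longrightarrow> v i - v j \<in> V"
    and G: "G face_of convex hull (v ` I)" "G \<noteq> {}"
  obtains u where "u \<in> V" "G = convex hull (v ` minimizers I (\<lambda>i. u \<bullet> v i))"
proof -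
  have "polyhedron (convex hull (v ` I))"
    using I polytope_convex_hull polytope_imp_polyhedron by blast
  then have "G exposed_face_of convex hull (v ` I)"
    using G exposed_face_of_polyhedron by blast
  then obtain a b where ab: "convex hull (v ` I) \<subseteq> {x. a \<bullet> x \<le> b}"
      "G = convex hull (v ` I) \<inter> {x. a \<bullet> x = b}"
    unfolding exposed_face_of_def by blast
  obtain p q where pq: "p \<in> span V" "\<And>w. w \<in> span V \<Longrightarrow> orthogonal q w" "a = p + q"
    using orthogonal_subspace_decomp_exists by metis
  have sp: "span V = V" using V by (simp add: span_eq_iff)
  obtain i0 where i0: "i0 \<in> I" using I by blast
  have q: "q \<bullet> v i = q \<bullet> v i0" if "i \<in> I" for i
    using pq(2)[of "v i - v i0"] d[OF that i0] sp by (simp add: orthogonal_def inner_diff_right)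
  have "v ` I \<subseteq> {x. q \<bullet> x = q \<bullet> v i0}" using q by auto
  then have qh: "convex hull (v ` I) \<subseteq> {x. q \<bullet> x = q \<bullet> v i0}"
    by (simp add: convex_hyperplane subset_hull)
  obtain g where g: "g \<in> G" using G by blast
  have eq: "(-p) \<bullet> x = q \<bullet> v i0 - a \<bullet> x" if "x \<in> convex hull (v ` I)" for x
    using qh that pq(3) by (auto simp: inner_add_left)
  have "G = {x \<in> convex hull (v ` I). \<forall>y\<in>convex hull (v ` I). (-p) \<bullet> x \<le> (-p) \<bullet> y}"
  proof -
    have "G = {x \<in> convex hull (v ` I). \<forall>y\<in>convex hull (v ` I). a \<bullet> y \<le> a \<bullet> x}"
      using ab g by force
    moreover have "(-p) \<bullet> x \<le> (-p) \<bullet> y \<longleftrightarrow> a \<bullet> y \<le> a \<bullet> x"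
      if "x \<in> convex hull (v ` I)" "y \<in> convex hull (v ` I)" for x y
      unfolding eq[OF that(1)] eq[OF that(2)] by linarith
    ultimately show ?thesis by blast
  qed
  then have "G = convex hull (v ` minimizers I (\<lambda>i. (-p) \<bullet> v i))"
    by (simp only: convex_hull_minimizers(1)[OF I])
  moreover have "-p \<in> V" using pq(1) sp V by (simp add: subspace_neg)
  ultimately show ?thesis using that by blast
qed

lemma normal_cone_convex_hull:
  fixes v :: "'i \<Rightarrow> 'a::euclidean_space"
  assumes I: "finite I" "I \<noteq> {}" and J: "J \<subseteq> I"
  shows "{u \<in> V. \<forall>x\<in>convex hull (v ` J). \<forall>y\<in>convex hull (v ` I). u \<bullet> x \<le> u \<bullet> y} =
    {u \<in> V. J \<subseteq> minimizers I (\<lambda>i. u \<bullet> v i)}"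
proof -
  have "(\<forall>x\<in>convex hull (v ` J). \<forall>y\<in>convex hull (v ` I). u \<bullet> x \<le> u \<bullet> y) \<longleftrightarrow>
      J \<subseteq> minimizers I (\<lambda>i. u \<bullet> v i)" for u
  proof
    assume "\<forall>x\<in>convex hull (v ` J). \<forall>y\<in>convex hull (v ` I). u \<bullet> x \<le> u \<bullet> y"
    then show "J \<subseteq> minimizers I (\<lambda>i. u \<bullet> v i)"
      using J by (auto simp: minimizers_def hull_inc)
  next
    assume "J \<subseteq> minimizers I (\<lambda>i. u \<bullet> v i)"
    then have "convex hull (v ` J) \<subseteq> convex hull (v ` minimizers I (\<lambda>i. u \<bullet> v i))"
      by (intro hull_mono image_mono)
    then show "\<forall>x\<in>convex hull (v ` J). \<forall>y\<in>convex hull (v ` I). u \<bullet> x \<le> u \<bullet> y"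
      unfolding convex_hull_minimizers(1)[OF I] by blast
  qed
  then show ?thesis by simp
qed

text \<open>The right-hand side sees the points only through minimizing index sets, so families with
  the same index sets have the same fan.\<close>

lemma inner_normal_fan_convex_hull:
  fixes v :: "'i \<Rightarrow> 'a::euclidean_space"
  assumes I: "finite I" "I \<noteq> {}" and V: "subspace V"
    and d: "\<And>i j. i \<in> I \<Longrightarrow> j \<in> I \<Longrightarrow> v i - v j \<in> V"
  shows "inner_normal_fan V (convex hull (v ` I)) =
    {{u' \<in> V. minimizers I (\<lambda>i. u \<bullet> v i) \<subseteq> minimizers I (\<lambda>i. u' \<bullet> v i)} | u. u \<in> V}"
    (is "?L = ?R")
proof
  show "?L \<subseteq> ?R"
  proof
    fix C assume "C \<in> ?L"
    then obtain G where G: "G face_of convex hull (v ` I)" "G \<noteq> {}"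
      and C: "C = {u \<in> V. \<forall>x\<in>G. \<forall>y\<in>convex hull (v ` I). u \<bullet> x \<le> u \<bullet> y}"
      by (auto simp: inner_normal_fan_def)
    obtain u where "u \<in> V" "G = convex hull (v ` minimizers I (\<lambda>i. u \<bullet> v i))"
      using face_of_convex_hull_minimizers[where V = V, OF I V d G] by blast
    then show "C \<in> ?R"
      using normal_cone_convex_hull[OF I minimizers_subset, of V v] C by blast
  qed
  show "?R \<subseteq> ?L"
  proof
    fix C assume "C \<in> ?R"
    then obtain u where u: "u \<in> V"
        "C = {u' \<in> V. minimizers I (\<lambda>i. u \<bullet> v i) \<subseteq> minimizers I (\<lambda>i. u' \<bullet> v i)}" by blast
    define G where "G = convex hull (v ` minimizers I (\<lambda>i. u \<bullet> v i))"
    have "C = {u \<in> V. \<forall>x\<in>G. \<forall>y\<in>convex hull (v ` I). u \<bullet> x \<le> u \<bullet> y}"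
      unfolding G_def u(2) using normal_cone_convex_hull[OF I minimizers_subset, of V v] by blast
    moreover have "G face_of convex hull (v ` I)"
      unfolding G_def by (rule convex_hull_minimizers(2)[OF I])
    moreover have "G \<noteq> {}"
      using minimizers_nonempty[OF I] by (simp add: G_def)
    ultimately show "C \<in> ?L" unfolding inner_normal_fan_def by blast
  qed
qed

text \<open>A direction \<open>q\<close> orthogonal to the face of \<open>v\<close> can be added to \<open>u\<close> with a small factor without
  losing minimizers; since \<open>w\<close> has the same minimizers, \<open>q\<close> is also orthogonal to the face of \<open>w\<close>.\<close>

lemma span_minimizers_subset:
  fixes v w :: "'i \<Rightarrow> 'a::euclidean_space"
  assumes I: "finite I" and V: "subspace V" and u: "u \<in> V"
    and d: "\<And>i j. i \<in> I \<Longrightarrow> j \<in> I \<Longrightarrow> w i - w j \<in> V" "\<And>i j. i \<in> I \<Longrightarrow> j \<in> I \<Longrightarrow> v i - v j \<in> V"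
    and eq: "\<And>u. u \<in> V \<Longrightarrow> minimizers I (\<lambda>i. u \<bullet> v i) = minimizers I (\<lambda>i. u \<bullet> w i)"
    and J: "J = minimizers I (\<lambda>i. u \<bullet> v i)" and i0: "i0 \<in> J"
  shows "span ((\<lambda>i. w i - w i0) ` J) \<subseteq> span ((\<lambda>i. v i - v i0) ` J)"
proof
  fix s assume s: "s \<in> span ((\<lambda>i. w i - w i0) ` J)"
  have JI: "J \<subseteq> I" unfolding J by (rule minimizers_subset)
  have inV: "span ((\<lambda>i. w i - w i0) ` J) \<subseteq> V" "span ((\<lambda>i. v i - v i0) ` J) \<subseteq> V"
    using d JI i0 by (intro span_minimal V; blast)+
  \<comment> \<open>The aim is \<open>q = 0\<close>: once \<open>q\<close> is known to be orthogonal
    to all differences of \<open>w\<close> on \<open>J\<close>, it is orthogonal to \<open>s\<close>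
    and to \<open>p\<close>, hence to \<open>q = s - p\<close>.\<close>
  obtain p q where pq: "p \<in> span ((\<lambda>i. v i - v i0) ` J)"
      "\<And>x. x \<in> span ((\<lambda>i. v i - v i0) ` J) \<Longrightarrow> orthogonal q x" "s = p + q"
    using orthogonal_subspace_decomp_exists by metis
  have qV: "q \<in> V"
    using pq(1,3) s inV V by (metis add_diff_cancel_left' subsetD subspace_diff)
  have qv: "q \<bullet> v j = q \<bullet> v i0" if "j \<in> J" for j
    using pq(2)[of "v j - v i0"] that
    by (auto simp: orthogonal_def inner_diff_right intro: span_base)
  have uv: "u \<bullet> v i0 < u \<bullet> v j" if "j \<in> I - J" for j
    using that i0 unfolding J by (auto simp: minimizers_def not_le intro: less_le_trans)
  have "\<forall>\<^sub>F \<epsilon> in at_right 0. (u + \<epsilon> *\<^sub>R q) \<bullet> v i0 < (u + \<epsilon> *\<^sub>R q) \<bullet> v j" if "j \<in> I - J" for j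
  proof (rule order_tendstoD(2)[THEN eventually_mono])
    show "((\<lambda>\<epsilon>. (u + \<epsilon> *\<^sub>R q) \<bullet> (v i0 - v j)) \<longlongrightarrow> (u + 0 *\<^sub>R q) \<bullet> (v i0 - v j)) (at_right 0)"
      by (intro tendsto_intros)
    show "(u + 0 *\<^sub>R q) \<bullet> (v i0 - v j) < 0" using uv[OF that] by (simp add: inner_diff_right)
  qed (simp add: inner_diff_right)
  then have "\<forall>\<^sub>F \<epsilon> in at_right 0. \<forall>j\<in>I - J. (u + \<epsilon> *\<^sub>R q) \<bullet> v i0 < (u + \<epsilon> *\<^sub>R q) \<bullet> v j"
    using I by (simp add: eventually_ball_finite)
  moreover have "\<forall>\<^sub>F \<epsilon> in at_right (0::real). \<epsilon> > 0"
    by (simp add: eventually_at_right_less)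
  ultimately have "\<forall>\<^sub>F \<epsilon> in at_right 0. \<epsilon> > 0 \<and> (\<forall>j\<in>I - J. (u + \<epsilon> *\<^sub>R q) \<bullet> v i0 < (u + \<epsilon> *\<^sub>R q) \<bullet> v j)"
    by (rule eventually_conj[rotated])
  then obtain \<epsilon> :: real where \<epsilon>: "\<epsilon> > 0"
      "\<And>j. j \<in> I - J \<Longrightarrow> (u + \<epsilon> *\<^sub>R q) \<bullet> v i0 < (u + \<epsilon> *\<^sub>R q) \<bullet> v j"
    using eventually_happens[of _ "at_right (0::real)"] trivial_limit_at_right_real by blast
  define u' where "u' = u + \<epsilon> *\<^sub>R q"
  have u'V: "u' \<in> V" unfolding u'_def using u qV V by (simp add: subspace_add subspace_scale)
  have uJ: "u \<bullet> v j = u \<bullet> v i0" if "j \<in> J" for j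
    using that i0 unfolding J by (auto simp: minimizers_def intro: antisym)
  have u'J: "u' \<bullet> v j = u' \<bullet> v i0" if "j \<in> J" for j
    using uJ[OF that] qv[OF that] by (simp add: u'_def inner_add_left)
  have "u' \<bullet> v i0 \<le> u' \<bullet> v j" if "j \<in> I" for j
    using \<epsilon>(2)[of j] u'J[of j] that by (cases "j \<in> J") (auto simp: u'_def)
  then have "J \<subseteq> minimizers I (\<lambda>i. u' \<bullet> v i)"
    using JI u'J by (auto simp: minimizers_def)
  then have m: "J \<subseteq> minimizers I (\<lambda>i. u' \<bullet> w i)" "J \<subseteq> minimizers I (\<lambda>i. u \<bullet> w i)"
    using eq u u'V J by auto
  have qw: "q \<bullet> (w j - w i0) = 0" if "j \<in> J" for j
  proof -
    have "u' \<bullet> w j = u' \<bullet> w i0" "u \<bullet> w j = u \<bullet> w i0"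
      using m that i0 JI by (auto simp: minimizers_def subset_iff intro!: antisym)
    then show ?thesis using \<epsilon>(1) by (simp add: u'_def inner_add_left inner_diff_right)
  qed
  have "orthogonal q s"
    using s qw by (intro orthogonal_to_span[of s "(\<lambda>i. w i - w i0) ` J"]) (auto simp: orthogonal_def)
  then have "q \<bullet> q = 0"
    using pq by (auto simp: orthogonal_def inner_add_right)
  then show "s \<in> span ((\<lambda>i. v i - v i0) ` J)" using pq by simp
qed

text \<open>The face map \<open>\<phi> v w\<close> sends a face to the hull of the
  \<open>w\<close>-points whose \<open>v\<close>-points lie in it, so the face selected by
  \<open>u\<close> goes to the face selected by \<open>u\<close>. The inverse is
  \<open>\<phi> w v\<close>. Affine hulls of corresponding faces are parallel since the spans of
  differences contain each other.\<close>

lemma normally_equivalent_if_same_minimizers: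
  fixes v w :: "'i \<Rightarrow> 'a::euclidean_space"
  assumes I: "finite I" "I \<noteq> {}" and V: "subspace V"
    and dv: "\<And>i j. i \<in> I \<Longrightarrow> j \<in> I \<Longrightarrow> v i - v j \<in> V"
    and dw: "\<And>i j. i \<in> I \<Longrightarrow> j \<in> I \<Longrightarrow> w i - w j \<in> V"
    and eq: "\<And>u. u \<in> V \<Longrightarrow> minimizers I (\<lambda>i. u \<bullet> v i) = minimizers I (\<lambda>i. u \<bullet> w i)"
  shows "normally_equivalent V (convex hull (v ` I)) (convex hull (w ` I))"
proof -
  define \<phi> where "\<phi> v w G = convex hull (w ` {i \<in> I. v i \<in> G})" for v w :: "'i \<Rightarrow> 'a" and G
  define face where "face v u = convex hull (v ` minimizers I (\<lambda>i. u \<bullet> v i))"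
    for v :: "'i \<Rightarrow> 'a" and u
  have \<phi>_face: "\<phi> v w (face v u) = face w u"
    if "u \<in> V" "\<And>u. u \<in> V \<Longrightarrow> minimizers I (\<lambda>i. u \<bullet> v i) = minimizers I (\<lambda>i. u \<bullet> w i)" for v w u
  proof -
    have "{i \<in> I. v i \<in> face v u} = minimizers I (\<lambda>i. u \<bullet> v i)"
      using mem_convex_hull_minimizers_iff[OF I(1), of _ v u] minimizers_subset
      by (fastforce simp: face_def)
    then show ?thesis using that by (simp add: \<phi>_def face_def)
  qed
  have \<phi>_empty: "\<phi> v w {} = {}" for v w by (simp add: \<phi>_def)
  have cases: "G = {} \<or> (\<exists>u\<in>V. G = face v u)" if "G face_of convex hull (v ` I)"
    "\<And>i j. i \<in> I \<Longrightarrow> j \<in> I \<Longrightarrow> v i - v j \<in> V" for v G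
    using face_of_convex_hull_minimizers[where V = V and v = v, OF I V that(2,1)]
    unfolding face_def by metis
  have face: "face v u face_of convex hull (v ` I)" for v u
    unfolding face_def by (rule convex_hull_minimizers(2)[OF I])
  note \<phi>1 = \<phi>_face[of _ v w, OF _ eq] and \<phi>2 = \<phi>_face[of _ w v, OF _ eq[symmetric]]
  have bij: "bij_betw (\<phi> v w) {G. G face_of convex hull (v ` I)} {G. G face_of convex hull (w ` I)}"
  proof (rule bij_betw_byWitness[where f' = "\<phi> w v"])
    show "\<forall>G\<in>{G. G face_of convex hull (v ` I)}. \<phi> w v (\<phi> v w G) = G"
      using cases[of _ v, OF _ dv] \<phi>1 \<phi>2 \<phi>_empty by fastforce
    show "\<forall>G\<in>{G. G face_of convex hull (w ` I)}. \<phi> v w (\<phi> w v G) = G"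
      using cases[of _ w, OF _ dw] \<phi>1 \<phi>2 \<phi>_empty by fastforce
    show "\<phi> v w ` {G. G face_of convex hull (v ` I)} \<subseteq> {G. G face_of convex hull (w ` I)}"
      using cases[of _ v, OF _ dv] \<phi>1 \<phi>_empty face by fastforce
    show "\<phi> w v ` {G. G face_of convex hull (w ` I)} \<subseteq> {G. G face_of convex hull (v ` I)}"
      using cases[of _ w, OF _ dw] \<phi>2 \<phi>_empty face by fastforce
  qed
  have aff: "\<exists>a. affine hull (\<phi> v w G) = (\<lambda>x. a + x) ` (affine hull G)"
    if G: "G face_of convex hull (v ` I)" for G
  proof (cases "G = {}")
    case False
    then obtain u where u: "u \<in> V" "G = face v u" using cases[OF G dv] by blast
    define J where "J = minimizers I (\<lambda>i. u \<bullet> v i)"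
    obtain i0 where i0: "i0 \<in> J" using minimizers_nonempty[OF I] unfolding J_def by blast
    have Jw: "J = minimizers I (\<lambda>i. u \<bullet> w i)" unfolding J_def by (rule eq[OF u(1)])
    have sp: "span ((\<lambda>i. v i - v i0) ` J) = span ((\<lambda>i. w i - w i0) ` J)"
      using span_minimizers_subset[where v = v and w = w, OF I(1) V u(1) dw dv eq J_def i0]
        span_minimizers_subset[where v = w and w = v, OF I(1) V u(1) dv dw eq[symmetric] Jw i0]
      by blast
    have hull: "affine hull (convex hull (v ` J)) = (\<lambda>x. v i0 + x) ` span ((\<lambda>i. v i - v i0) ` J)" for v
    proof -
      have "affine hull (convex hull (v ` J)) = affine hull (v ` J)"
        by (simp add: affine_hull_convex_hull)
      \<comment> \<open>The library form removes the base point from the generators; putting it back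
        adds only the vector 0 to the spanning set.\<close>
      also have "\<dots> = (\<lambda>x. v i0 + x) ` span ((\<lambda>x. x - v i0) ` v ` J)"
        using i0 affine_hull_span2[of "v i0" "v ` J"] span_insert_0[of "(\<lambda>x. x - v i0) ` (v ` J - {v i0})"]
          insert_Diff[of "v i0" "v ` J"] image_insert[of "\<lambda>x. x - v i0" "v i0" "v ` J - {v i0}"]
        by auto
      finally show ?thesis by (simp add: image_image)
    qed
    have "affine hull (\<phi> v w G) = (\<lambda>x. w i0 + x) ` span ((\<lambda>i. v i - v i0) ` J)"
      using hull[of w] \<phi>1[OF u(1)] u(2) Jw sp by (simp add: face_def)
    also have "\<dots> = (\<lambda>x. (w i0 - v i0) + x) ` (affine hull G)"
      using hull[of v] u(2) by (simp add: face_def J_def image_image)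
    finally show ?thesis by blast
  qed (simp add: \<phi>_empty)
  \<comment> \<open>The improper face is treated as a face too: parallelism of its affine hulls
    gives the equality of dimensions.\<close>
  have refl: "convex hull (v ` I) face_of convex hull (v ` I)"
    by (simp add: face_of_refl)
  have "\<phi> v w (convex hull (v ` I)) = convex hull (w ` I)"
  proof -
    have "{i \<in> I. v i \<in> convex hull (v ` I)} = I" by (auto intro: hull_inc)
    then show ?thesis by (simp add: \<phi>_def)
  qed
  then obtain a where "affine hull (convex hull (w ` I)) = (\<lambda>x. a + x) ` (affine hull (convex hull (v ` I)))"
    using aff[OF refl] by auto
  then have dim: "aff_dim (convex hull (v ` I)) = aff_dim (convex hull (w ` I))"
    by (metis aff_dim_affine_hull aff_dim_translation_eq)
  have mono: "\<phi> v w G \<subseteq> \<phi> v w G'" if "G \<subseteq> G'" for G G'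
    unfolding \<phi>_def using that by (intro hull_mono) auto
  have "strictly_comb_isomorphic (convex hull (v ` I)) (convex hull (w ` I))"
    unfolding strictly_comb_isomorphic_def
    using I by (intro conjI exI[of _ "\<phi> v w"] allI impI dim bij aff)
      (blast intro: polytope_convex_hull mono[THEN subsetD])+
  moreover have "inner_normal_fan V (convex hull (v ` I)) = inner_normal_fan V (convex hull (w ` I))"
    unfolding inner_normal_fan_convex_hull[where v = v, OF I V dv, simplified]
      inner_normal_fan_convex_hull[where v = w, OF I V dw, simplified]
    using eq by auto
  ultimately show ?thesis by (simp add: normally_equivalent_def)
qed

section \<open>Rankings and the braid fan\<close>

definition rankings :: "('i::finite \<Rightarrow> nat) set" where
  "rankings = {\<sigma>. bij_betw \<sigma> UNIV {..<CARD('i)}}"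

text \<open>Reversed linear extensions of the weak order induced by \<open>w\<close>; ties leave the
  order free. With \<open>w\<close> read as a functional, they index the vertices of the face of the
  permutohedron that it selects.\<close>

definition antitone_rankings :: "('i::finite \<Rightarrow> real) \<Rightarrow> ('i \<Rightarrow> nat) set" where
  "antitone_rankings w = {\<sigma> \<in> rankings. \<forall>i j. w i < w j \<longrightarrow> \<sigma> j < \<sigma> i}"

lemma finite_rankings: "finite (rankings :: ('i::finite \<Rightarrow> nat) set)"
proof (rule finite_subset)
  show "rankings \<subseteq> (UNIV :: 'i set) \<rightarrow>\<^sub>E {..<CARD('i)}"
    by (auto simp: rankings_def bij_betw_def PiE_def)
qed (intro finite_PiE; simp)

lemma rankings_nonempty: "(rankings :: ('i::finite \<Rightarrow> nat) set) \<noteq> {}"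
  using ex_bij_betw_finite_nat[of "UNIV :: 'i set"]
  by (auto simp: rankings_def atLeast0LessThan)

lemma rankings_transpose: "\<sigma> \<in> rankings \<Longrightarrow> \<sigma> \<circ> Transposition.transpose i j \<in> rankings"
  unfolding rankings_def by (auto intro: bij_betw_trans bij_transpose)

lemma rankings_less: "\<sigma> \<in> rankings \<Longrightarrow> \<sigma> (i::'i::finite) < CARD('i)"
  by (auto simp: rankings_def bij_betw_def)

lemma rankings_eq_iff: "\<sigma> \<in> rankings \<Longrightarrow> \<sigma> i = \<sigma> j \<longleftrightarrow> i = j"
  by (auto simp: rankings_def bij_betw_def inj_on_def)

lemma sum_rankings:
  "\<sigma> \<in> rankings \<Longrightarrow> (\<Sum>i\<in>UNIV. g (\<sigma> i)) = (\<Sum>t<CARD('i). g t)" for \<sigma> :: "'i::finite \<Rightarrow> nat"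
  unfolding rankings_def by (simp add: sum.reindex_bij_betw)

text \<open>Listing the weights by increasing rank puts their multiset into descending order, and a
  sorted list is determined by its multiset. The negation turns descending into the ascending order
  of \<open>sort\<close>.\<close>

lemma antitone_rankings_sorted_unique:
  fixes w :: "'i::finite \<Rightarrow> real"
  assumes \<sigma>: "\<sigma> \<in> antitone_rankings w" and \<tau>: "\<tau> \<in> antitone_rankings w" and t: "t < CARD('i)"
  shows "w (inv \<sigma> t) = w (inv \<tau> t)"
proof -
  define l where "l \<sigma> = map (\<lambda>t. - w (inv \<sigma> t)) [0..<CARD('i)]" for \<sigma> :: "'i \<Rightarrow> nat"
  have sorted: "sort (map (\<lambda>i. - w i) xs) = l \<sigma>"
    if \<sigma>: "\<sigma> \<in> antitone_rankings w" and xs: "mset xs = mset_set UNIV" for \<sigma> xs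
  proof (rule properties_for_sort)
    have bij: "bij_betw \<sigma> UNIV {..<CARD('i)}"
      using \<sigma> by (simp add: antitone_rankings_def rankings_def)
    have "\<sigma> (inv \<sigma> t) = t" if "t < CARD('i)" for t
      using bij that by (intro f_inv_into_f) (simp add: bij_betw_def)
    then have "- w (inv \<sigma> s) \<le> - w (inv \<sigma> t)" if "s \<le> t" "t < CARD('i)" for s t
      using \<sigma> that by (force simp: antitone_rankings_def not_less[symmetric])
    then show "sorted (l \<sigma>)"
      by (auto simp: l_def sorted_iff_nth_mono)
    have inv: "bij_betw (inv \<sigma>) {0..<CARD('i)} UNIV"
      using bij_betw_inv_into[OF bij] by (simp add: atLeast0LessThan)
    have "image_mset (inv \<sigma>) (mset_set {0..<CARD('i)}) = mset_set UNIV"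
      using inv by (simp add: image_mset_mset_set bij_betw_def)
    then have "image_mset (\<lambda>i. - w i) (image_mset (inv \<sigma>) (mset_set {0..<CARD('i)}))
        = image_mset (\<lambda>i. - w i) (mset xs)" using xs by simp
    then show "mset (l \<sigma>) = mset (map (\<lambda>i. - w i) xs)"
      by (simp add: l_def multiset.map_comp comp_def)
  qed
  obtain xs :: "'i list" where xs: "mset xs = mset_set UNIV"
    using ex_mset by blast
  have "l \<sigma> ! t = l \<tau> ! t" using sorted[OF \<sigma> xs] sorted[OF \<tau> xs] by simp
  then show ?thesis using t by (simp add: l_def)
qed

text \<open>An exchange argument shows that minimizers are antitone; conversely, all antitone rankings
  have the same value since they list the weights in the same order.\<close>

lemma minimizers_rankings:
  fixes w :: "'i::finite \<Rightarrow> real" and f :: "nat \<Rightarrow> real"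
  assumes f: "\<And>s t. s < t \<Longrightarrow> t < CARD('i) \<Longrightarrow> f s < f t"
  shows "minimizers rankings (\<lambda>\<sigma>. \<Sum>i\<in>UNIV. w i * f (\<sigma> i)) = antitone_rankings w"
    (is "minimizers _ ?c = _")
proof
  show sub: "minimizers rankings ?c \<subseteq> antitone_rankings w"
  proof
    fix \<sigma> assume \<sigma>: "\<sigma> \<in> minimizers rankings ?c"
    then have r: "\<sigma> \<in> rankings" by (simp add: minimizers_def)
    have "\<sigma> j < \<sigma> i" if ij: "w i < w j" for i j
    proof (rule ccontr)
      assume "\<not> \<sigma> j < \<sigma> i"
      have "i \<noteq> j" using ij by blast
      then have lt: "\<sigma> i < \<sigma> j" using \<open>\<not> \<sigma> j < \<sigma> i\<close> rankings_eq_iff[OF r, of i j] ij by (cases "i = j") auto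
      define \<tau> where "\<tau> = \<sigma> \<circ> Transposition.transpose i j"
      have \<tau>: "\<tau> i = \<sigma> j" "\<tau> j = \<sigma> i" "\<And>x. x \<notin> {i, j} \<Longrightarrow> \<tau> x = \<sigma> x"
        by (auto simp: \<tau>_def)
      have "?c \<sigma> - ?c \<tau> = (\<Sum>x\<in>UNIV. w x * (f (\<sigma> x) - f (\<tau> x)))"
        by (simp add: sum_subtractf right_diff_distrib)
      also have "\<dots> = (\<Sum>x\<in>{i, j}. w x * (f (\<sigma> x) - f (\<tau> x)))"
        by (rule sum.mono_neutral_right) (auto simp: \<tau>(3))
      also have "\<dots> = (w j - w i) * (f (\<sigma> j) - f (\<sigma> i))"
        using \<open>i \<noteq> j\<close> by (simp add: \<tau>) (simp add: algebra_simps)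
      also have "\<dots> > 0"
        using ij f[OF lt] rankings_less[OF r] by simp
      finally have "?c \<tau> < ?c \<sigma>" by simp
      moreover have "\<tau> \<in> rankings" unfolding \<tau>_def by (rule rankings_transpose[OF r])
      ultimately show False using \<sigma> by (force simp: minimizers_def)
    qed
    then show "\<sigma> \<in> antitone_rankings w" using r by (simp add: antitone_rankings_def)
  qed
  show "antitone_rankings w \<subseteq> minimizers rankings ?c"
  proof
    fix \<sigma> assume \<sigma>: "\<sigma> \<in> antitone_rankings w"
    obtain \<tau> where \<tau>: "\<tau> \<in> minimizers rankings ?c"
      using minimizers_nonempty[OF finite_rankings rankings_nonempty] by blast
    then have \<tau>': "\<tau> \<in> antitone_rankings w" using sub by blast
    have c: "?c \<sigma> = (\<Sum>t<CARD('i). w (inv \<sigma> t) * f t)" if "\<sigma> \<in> antitone_rankings w" for \<sigma>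
    proof -
      have r: "\<sigma> \<in> rankings" using that by (simp add: antitone_rankings_def)
      then have "inv \<sigma> (\<sigma> i) = i" for i by (simp add: rankings_def bij_betw_def)
      then show ?thesis using sum_rankings[OF r, of "\<lambda>t. w (inv \<sigma> t) * f t"] by simp
    qed
    have "?c \<sigma> = ?c \<tau>"
      unfolding c[OF \<sigma>] c[OF \<tau>'] using antitone_rankings_sorted_unique[OF \<sigma> \<tau>'] by simp
    then show "\<sigma> \<in> minimizers rankings ?c"
      using \<tau> \<sigma> by (simp add: minimizers_def antitone_rankings_def)
  qed
qed

text \<open>A linear extension exists because a minimizer does; no sorting construction is
  involved.\<close>

lemma antitone_rankings_nonempty: "antitone_rankings w \<noteq> {}"
  unfolding minimizers_rankings[of real w, simplified, symmetric]
  by (rule minimizers_nonempty[OF finite_rankings rankings_nonempty])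

lemma antitone_rankingsD:
  assumes "\<sigma> \<in> antitone_rankings w"
  shows "\<sigma> \<in> rankings" "w i < w j \<Longrightarrow> \<sigma> j < \<sigma> i"
  using assms by (simp_all add: antitone_rankings_def)

text \<open>Suppose \<open>w i \<le> w j\<close> but \<open>u i > u j\<close>. Then every antitone
  ranking of \<open>w\<close> would put \<open>i\<close> before \<open>j\<close>. A strict
  inequality of \<open>w\<close> forbids this directly; in a tie, exchanging the ranks of
  \<open>i\<close> and \<open>j\<close> gives another antitone ranking with the opposite
  order.\<close>

lemma antitone_rankings_subset_iff:
  "antitone_rankings w \<subseteq> antitone_rankings u \<longleftrightarrow> (\<forall>i j. w i \<le> w j \<longrightarrow> u i \<le> u j)"
proof
  assume sub: "antitone_rankings w \<subseteq> antitone_rankings u"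
  show "\<forall>i j. w i \<le> w j \<longrightarrow> u i \<le> u j"
  proof (intro allI impI, rule ccontr)
    fix i j assume w: "w i \<le> w j" and u: "\<not> u i \<le> u j"
    obtain \<sigma> where \<sigma>: "\<sigma> \<in> antitone_rankings w" using antitone_rankings_nonempty by blast
    note r = antitone_rankingsD(1)[OF \<sigma>]
    have s: "\<sigma> i < \<sigma> j"
      using antitone_rankingsD(2)[OF subsetD[OF sub \<sigma>], of j i] u by simp
    have "\<not> w i < w j" using antitone_rankingsD(2)[OF \<sigma>, of i j] s by linarith
    then have eq: "w i = w j" using w by simp
    define \<tau> where "\<tau> = \<sigma> \<circ> Transposition.transpose i j"
    have "w (Transposition.transpose i j x) = w x" for x using eq by (simp add: Transposition.transpose_def)
    then have "\<tau> y < \<tau> x" if "w x < w y" for x y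
      using antitone_rankingsD(2)[OF \<sigma>] that by (simp add: \<tau>_def)
    then have \<tau>: "\<tau> \<in> antitone_rankings w"
      using rankings_transpose[OF r] by (simp add: antitone_rankings_def \<tau>_def)
    have "\<tau> i < \<tau> j"
      using antitone_rankingsD(2)[OF subsetD[OF sub \<tau>], of j i] u by simp
    then show False using s by (simp add: \<tau>_def)
  qed
next
  assume "\<forall>i j. w i \<le> w j \<longrightarrow> u i \<le> u j"
  then have "w i < w j" if "u i < u j" for i j using that by (meson not_le)
  then show "antitone_rankings w \<subseteq> antitone_rankings u"
    unfolding antitone_rankings_def by blast
qed

section \<open>Cones of the quotient fan as weak orders\<close>

lemma coord_sum_linear: "linear coord_sum"
  by (rule linearI) (simp_all add: coord_sum_def sum.distrib sum_distrib_left)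

lemmas coord_sum_simps = linear_add[OF coord_sum_linear] linear_diff[OF coord_sum_linear]
  linear_scale[OF coord_sum_linear] linear_0[OF coord_sum_linear]

definition zero_sum :: "(real ^ 'n) set" where
  "zero_sum = {x. coord_sum x = 0}"

lemma subspace_zero_sum: "subspace zero_sum"
  unfolding zero_sum_def by (simp add: coord_sum_linear linear_subspace_kernel)

text \<open>The projection subtracts the mean, so the shift \<open>t\<close> is the mean of a
  preimage. The sets \<open>s i\<close> are arbitrary, which also covers the range of the
  projection.\<close>

lemma mem_image_diag_quotient:
  "u \<in> diag_quotient ` {w. \<forall>i. w $ i \<in> s i} \<longleftrightarrow> coord_sum u = 0 \<and> (\<exists>t. \<forall>i. u $ i + t \<in> s i)"
  for u :: "real ^ 'n"
proof
  assume "u \<in> diag_quotient ` {w. \<forall>i. w $ i \<in> s i}"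
  then obtain w where w: "u = diag_quotient w" "\<forall>i. w $ i \<in> s i" by blast
  have "coord_sum u = 0"
    unfolding w(1) by (simp add: diag_quotient_def coord_sum_def sum_subtractf)
  moreover have "\<forall>i. u $ i + coord_sum w / real CARD('n) \<in> s i"
    using w by (simp add: diag_quotient_def)
  ultimately show "coord_sum u = 0 \<and> (\<exists>t. \<forall>i. u $ i + t \<in> s i)" by blast
next
  assume "coord_sum u = 0 \<and> (\<exists>t. \<forall>i. u $ i + t \<in> s i)"
  then obtain t where t: "coord_sum u = 0" "\<forall>i. u $ i + t \<in> s i" by blast
  define w where "w = (\<chi> i. u $ i + t)"
  have "coord_sum w = real CARD('n) * t"
    using t(1) by (simp add: w_def coord_sum_def sum.distrib)
  then have "u = diag_quotient w" by (simp add: diag_quotient_def vec_eq_iff w_def)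
  then show "u \<in> diag_quotient ` {w. \<forall>i. w $ i \<in> s i}"
    using t(2) by (auto simp: w_def)
qed

lemma range_diag_quotient: "range diag_quotient = zero_sum"
  using mem_image_diag_quotient[of _ "\<lambda>_. UNIV"] by (auto simp: zero_sum_def)

text \<open>The refinement is the braid fan. One test cone for each coordinate \<open>i\<close>
  detects all comparisons with \<open>w $ i\<close>. Conversely, a cone through a shift of
  \<open>w\<close> only separates coordinates at a threshold, and any \<open>u\<close> that is
  monotone in \<open>w\<close> admits a threshold separating them in the same way.\<close>

lemma quotient_fan_cone:
  fixes w :: "real ^ 'n"
  assumes w: "coord_sum w = 0"
  shows "\<Inter>{D \<in> (`) diag_quotient ` P1_power_fan. w \<in> D} =
    {u \<in> zero_sum. \<forall>i j. w $ i \<le> w $ j \<longrightarrow> u $ i \<le> u $ j}" (is "\<Inter>?D = ?C")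
proof (intro equalityI subsetI)
  fix u assume u: "u \<in> \<Inter>?D"
  have "coord_sum u = 0 \<and> (\<forall>j. w $ i \<le> w $ j \<longrightarrow> u $ i \<le> u $ j)" for i
  proof -
    \<comment> \<open>The signs of \<open>w\<close> after the diagonal shift that makes coordinate
      \<open>i\<close> zero.\<close>
    define s where "s j = (if w $ j = w $ i then {0} else if w $ i < w $ j then {0..} else {..0::real})"
      for j
    have "{w. \<forall>j. w $ j \<in> s j} \<in> P1_power_fan"
      unfolding P1_power_fan_def by (intro CollectI exI[of _ s]) (simp add: P1_fan_def s_def)
    moreover have "w \<in> diag_quotient ` {w. \<forall>j. w $ j \<in> s j}"
      unfolding mem_image_diag_quotient using w by (auto simp: s_def intro!: exI[of _ "- w $ i"])
    ultimately have "u \<in> diag_quotient ` {w. \<forall>j. w $ j \<in> s j}"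
      using u by blast
    then obtain t where t: "coord_sum u = 0" "\<And>j. u $ j + t \<in> s j"
      unfolding mem_image_diag_quotient by blast
    have "u $ i \<le> u $ j" if "w $ i \<le> w $ j" for j
      using t(2)[of i] t(2)[of j] that by (auto simp: s_def split: if_splits)
    then show ?thesis using t(1) by blast
  qed
  then show "u \<in> ?C" by (simp add: zero_sum_def)
next
  fix u assume u: "u \<in> ?C"
  then have mono: "w $ i \<le> w $ j \<Longrightarrow> u $ i \<le> u $ j" for i j by blast
  show "u \<in> \<Inter>?D"
  proof
    fix D assume "D \<in> ?D"
    then obtain W where "W \<in> P1_power_fan" and DW: "D = diag_quotient ` W" and wD: "w \<in> D"
      by blast
    then obtain s where s: "\<And>i. s i \<in> P1_fan" and W: "W = {w. \<forall>i. w $ i \<in> s i}"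
      unfolding P1_power_fan_def by blast
    have D: "D = diag_quotient ` {w. \<forall>i. w $ i \<in> s i}" unfolding DW W ..
    have cases: "s i = {0} \<or> s i = {0..} \<or> s i = {..0}" for i
      using s[of i] by (simp add: P1_fan_def)
    obtain t where t: "\<And>i. w $ i + t \<in> s i" using wD unfolding D mem_image_diag_quotient by blast
    have "\<exists>t. \<forall>i. u $ i + t \<in> s i"
    proof (cases "\<exists>i. s i = {0}")
      case True
      then obtain i where i: "s i = {0}" by blast
      then have "t = - w $ i" using t[of i] by simp
      then have "u $ j + - u $ i \<in> s j" for j
        using cases[of j] t[of j] mono[of i j] mono[of j i] by (elim disjE) simp_all
      then show ?thesis by blast
    next
      case False
      then have s': "s i = {0..} \<or> s i = {..0}" for i using cases by metis
      \<comment> \<open>Each coordinate is now constrained to one side. The threshold for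
        \<open>u\<close> is its maximum over the nonpositive side \<open>A\<close>, or its overall
        minimum if that side is empty. Members of \<open>A\<close> have \<open>w\<close>-value at
        most \<open>- t\<close> and all others at least \<open>- t\<close>, so monotonicity
        applies.\<close>
      define A where "A = {i. s i = {..0}}"
      show ?thesis
      proof (cases "A = {}")
        case True
        define b where "b = Min (range (($) u))"
        have "u $ i + - b \<in> s i" for i
        proof -
          have "b \<le> u $ i" by (simp add: b_def)
          moreover have "s i = {0..}" using s'[of i] True by (auto simp: A_def)
          ultimately show ?thesis by simp
        qed
        then show ?thesis by blast
      next
        case False
        define b where "b = Max (($) u ` A)"
        have "u $ i + - b \<in> s i" for i
        proof (cases "i \<in> A")
          case False
          then have si: "s i = {0..}" using s'[of i] by (auto simp: A_def)
          have "u $ j \<le> u $ i" if "j \<in> A" for j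
            using mono[of j i] t[of i] t[of j] si that by (auto simp: A_def)
          then have "b \<le> u $ i" unfolding b_def using \<open>A \<noteq> {}\<close> by (intro Max.boundedI) auto
          then show ?thesis by (simp add: si)
        qed (simp add: A_def b_def)
        then show ?thesis by blast
      qed
    qed
    then show "u \<in> D" unfolding D mem_image_diag_quotient using u by (simp add: zero_sum_def)
  qed
qed

lemma quotient_fan_eq:
  "quotient_fan =
    {{u \<in> zero_sum. \<forall>i j. w $ i \<le> w $ j \<longrightarrow> u $ i \<le> u $ j} | w :: real ^ 'n. w \<in> zero_sum}"
  unfolding quotient_fan_def common_refinement_def range_diag_quotient setcompr_eq_image
  by (intro image_cong refl quotient_fan_cone) (simp add: zero_sum_def)

text \<open>The rank values \<open>f\<close> are kept general because the slices of the
  permutohedron have a gap in theirs.\<close>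

definition rank_vec :: "(nat \<Rightarrow> real) \<Rightarrow> ('n::finite \<Rightarrow> nat) \<Rightarrow> real ^ 'n" where
  "rank_vec f \<sigma> = (\<chi> i. f (\<sigma> i))"

lemma coord_sum_rank_vec:
  "\<sigma> \<in> rankings \<Longrightarrow> coord_sum (rank_vec f \<sigma> :: real ^ 'n) = (\<Sum>t<CARD('n). f t)"
  using sum_rankings[of \<sigma> f] by (simp add: coord_sum_def rank_vec_def)

lemma inner_rank_vec: "u \<bullet> rank_vec f \<sigma> = (\<Sum>i\<in>UNIV. u $ i * f (\<sigma> i))"
  by (simp add: inner_vec_def rank_vec_def)

lemma minimizers_rank_vec:
  "minimizers rankings (\<lambda>\<sigma>. u \<bullet> (a + rank_vec real \<sigma>)) = antitone_rankings (($) u)"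
  using minimizers_rankings[of real "($) u"]
  by (simp add: minimizers_def inner_add_right inner_rank_vec)

lemma inner_normal_fan_permutohedron:
  "inner_normal_fan zero_sum (convex hull ((\<lambda>\<sigma>. a + rank_vec real \<sigma>) ` rankings)) =
    (quotient_fan :: (real ^ 'n) set set)"
proof -
  have "inner_normal_fan zero_sum (convex hull ((\<lambda>\<sigma>. a + rank_vec real \<sigma>) ` rankings)) =
    {{u \<in> zero_sum. antitone_rankings (($) w) \<subseteq> antitone_rankings (($) u)} | w::real^'n. w \<in> zero_sum}"
    unfolding minimizers_rank_vec[of _ a, symmetric]
    by (rule inner_normal_fan_convex_hull[OF finite_rankings rankings_nonempty subspace_zero_sum])
      (simp add: zero_sum_def coord_sum_simps coord_sum_rank_vec)
  then show ?thesis unfolding quotient_fan_eq antitone_rankings_subset_iff .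
qed

section \<open>The fiber polytope of the cube\<close>

definition unit_cube :: "(real ^ 'n) set" where
  "unit_cube = {x. \<forall>i. x $ i \<in> Delta1}"

lemma Delta1_eq: "Delta1 = {0..1}"
  by (simp add: Delta1_def segment_convex_hull[symmetric] closed_segment_eq_real_ivl)

lemma convex_unit_cube: "convex (unit_cube :: (real ^ 'n) set)"
proof -
  have eq: "unit_cube = cbox 0 (1 :: real ^ 'n)"
    by (auto simp: unit_cube_def Delta1_eq mem_box_cart)
  show ?thesis unfolding eq by (rule convex_box)
qed

text \<open>The height of a coordinate that is raised from 0 to 1 while the coordinate sum runs from
  \<open>t\<close> to \<open>t + 1\<close>.\<close>

definition ramp :: "real \<Rightarrow> real \<Rightarrow> real" where
  "ramp t y = max 0 (min 1 (y - t))"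

lemma sum_ramp: "0 \<le> y \<Longrightarrow> (\<Sum>t<n. ramp (real t) y) = min y (real n)"
  by (induction n) (auto simp: ramp_def)

text \<open>Zero up to \<open>t\<close>, then a triangle of area 1/2, then a plateau of length
  \<open>b - (t + 1)\<close>. The triangle is the origin of the shift by 1/2 in every coordinate of
  the fiber polytope.\<close>

lemma has_integral_ramp:
  assumes "0 \<le> t" "t + 1 \<le> b"
  shows "(ramp t has_integral b - t - 1/2) {0..b}"
proof -
  have "(ramp t has_integral 0) {0..t}"
    by (rule has_integral_eq[OF _ has_integral_0]) (auto simp: ramp_def)
  moreover have "(ramp t has_integral 1/2) {t..t + 1}"
  proof (rule has_integral_eq)
    have "((\<lambda>y. y - t) has_integral ((t + 1)\<^sup>2 - t\<^sup>2) / 2 - t * (t + 1 - t)) {t..t + 1}"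
      using has_integral_const_real[of t t "t + 1"]
      by (intro has_integral_diff ident_has_integral) (auto simp: mult.commute)
    then show "((\<lambda>y. y - t) has_integral 1/2) {t..t + 1}"
      by (simp add: power2_eq_square field_simps)
  qed (auto simp: ramp_def)
  moreover have "(ramp t has_integral b - (t + 1)) {t + 1..b}"
  proof (rule has_integral_eq)
    show "((\<lambda>y. 1) has_integral b - (t + 1)) {t + 1..b}"
      using has_integral_const_real[of "1::real" "t + 1" b] assms by simp
  qed (auto simp: ramp_def)
  ultimately have "(ramp t has_integral 0 + 1/2 + (b - (t + 1))) {0..b}"
    using assms
    by (intro has_integral_combine[where c = "t + 1" and b = b and a = 0]
        has_integral_combine[where c = t and b = "t + 1" and a = 0]) auto
  then show ?thesis by (simp add: algebra_simps)
qed

text \<open>The monotone edge path of the unit cube that raises the coordinates in the order given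
  by \<open>\<sigma>\<close>, parametrised by the coordinate sum.\<close>

definition edge_path :: "('n \<Rightarrow> nat) \<Rightarrow> real \<Rightarrow> real ^ 'n" where
  "edge_path \<sigma> y = (\<chi> i. ramp (real (\<sigma> i)) y)"

lemma continuous_on_edge_path: "continuous_on S (edge_path \<sigma>)"
  unfolding edge_path_def ramp_def by (intro continuous_intros)

lemma edge_path_in_unit_cube: "edge_path \<sigma> y \<in> unit_cube"
  by (simp add: edge_path_def unit_cube_def Delta1_eq ramp_def)

lemma coord_sum_edge_path:
  fixes \<sigma> :: "'n::finite \<Rightarrow> nat"
  assumes "\<sigma> \<in> rankings" "y \<in> {0..real CARD('n)}"
  shows "coord_sum (edge_path \<sigma> y) = y"
  using sum_rankings[OF assms(1), of "\<lambda>t. ramp (real t) y"] sum_ramp[of y "CARD('n)"] assms(2)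
  by (simp add: coord_sum_def edge_path_def)

lemma coord_sum_image_unit_cube:
  "coord_sum ` (unit_cube :: (real ^ 'n) set) = {0..real CARD('n)}"
proof
  have "coord_sum x \<in> {0..real CARD('n)}" if "x \<in> unit_cube" for x :: "real ^ 'n"
    using that sum_bounded_above[of UNIV "($) x" 1]
    by (auto simp: coord_sum_def unit_cube_def Delta1_eq intro!: sum_nonneg)
  then show "coord_sum ` (unit_cube :: (real ^ 'n) set) \<subseteq> {0..real CARD('n)}" by blast
next
  obtain \<sigma> :: "'n \<Rightarrow> nat" where "\<sigma> \<in> rankings" using rankings_nonempty by blast
  then show "{0..real CARD('n)} \<subseteq> coord_sum ` (unit_cube :: (real ^ 'n) set)"
    using coord_sum_edge_path edge_path_in_unit_cube by (metis imageI subsetI)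
qed

text \<open>A coordinate raised early has a large integral, so integrating an edge path reverses its
  ranking.\<close>

lemma rankings_reverse:
  fixes \<sigma> :: "'i::finite \<Rightarrow> nat"
  assumes "\<sigma> \<in> rankings"
  shows "(\<lambda>i. CARD('i) - 1 - \<sigma> i) \<in> rankings"
proof -
  have "bij_betw (\<lambda>t. CARD('i) - 1 - t) {..<CARD('i)} {..<CARD('i)}"
    by (rule bij_betw_byWitness[where f' = "\<lambda>t. CARD('i) - 1 - t"]) auto
  then show ?thesis
    using assms bij_betw_trans[of \<sigma> UNIV "{..<CARD('i)}"]
    by (simp add: rankings_def comp_def)
qed

lemma integral_edge_path:
  fixes \<sigma> :: "'n::finite \<Rightarrow> nat"
  assumes "\<sigma> \<in> rankings"
  shows "integral {0..real CARD('n)} (edge_path \<sigma>) =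
    (\<chi> i. 1/2) + rank_vec real (\<lambda>i. CARD('n) - 1 - \<sigma> i)"
proof -
  have int: "edge_path \<sigma> integrable_on {0..real CARD('n)}"
    by (rule integrable_continuous_real[OF continuous_on_edge_path])
  have "integral {0..real CARD('n)} (edge_path \<sigma>) $ i = 1/2 + real (CARD('n) - 1 - \<sigma> i)" for i
  proof -
    have "real (\<sigma> i) + 1 \<le> real CARD('n)" using rankings_less[OF assms, of i] by linarith
    then have "integral {0..real CARD('n)} (ramp (real (\<sigma> i))) = real CARD('n) - real (\<sigma> i) - 1/2"
      by (intro integral_unique has_integral_ramp) auto
    moreover have "integral {0..real CARD('n)} (edge_path \<sigma>) $ i =
        integral {0..real CARD('n)} (ramp (real (\<sigma> i)))"
      using integral_component_eq_cart[OF int, of i] by (simp add: edge_path_def)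
    moreover have "real (CARD('n) - 1 - \<sigma> i) = real CARD('n) - 1 - real (\<sigma> i)"
      using rankings_less[OF assms, of i] by linarith
    ultimately show ?thesis by simp
  qed
  then show ?thesis by (simp add: vec_eq_iff rank_vec_def)
qed

text \<open>The greedy solution of the fractional knapsack problem: among the points of the unit cube
  with coordinate sum \<open>y\<close>, a linear functional is minimized by raising the cheapest
  coordinates first.\<close>

lemma inner_edge_path_le:
  fixes u :: "real ^ 'n"
  assumes \<sigma>: "\<sigma> \<in> antitone_rankings (\<lambda>i. - u $ i)" and x: "x \<in> unit_cube"
  shows "u \<bullet> edge_path \<sigma> (coord_sum x) \<le> u \<bullet> x"
proof -
  define y where "y = coord_sum x"
  define p where "p = edge_path \<sigma> y"
  note r = antitone_rankingsD(1)[OF \<sigma>]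
  have y: "y \<in> {0..real CARD('n)}"
    using x coord_sum_image_unit_cube unfolding y_def by blast
  have x01: "0 \<le> x $ i" "x $ i \<le> 1" for i using x by (auto simp: unit_cube_def Delta1_eq)
  \<comment> \<open>The critical item \<open>k\<close> of the knapsack: coordinates ranked before it
    are full at height \<open>y\<close>, those after it empty. The cap at
    \<open>CARD('n) - 1\<close> serves \<open>y = CARD('n)\<close>, whose floor is not a
    rank.\<close>
  define t where "t = min (nat \<lfloor>y\<rfloor>) (CARD('n) - 1)"
  have "t < CARD('n)" by (simp add: t_def min_less_iff_disj)
  then have "t \<in> range \<sigma>" using r by (simp add: rankings_def bij_betw_def)
  then obtain k where k: "\<sigma> k = t" by blast
  \<comment> \<open>The cost \<open>u $ k\<close> acts as a Lagrange multiplier: it makes every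
    summand nonnegative and cancels in the total, because \<open>x\<close> and \<open>p\<close> have
    equal coordinate sums.\<close>
  have "0 \<le> (u $ i - u $ k) * (x $ i - p $ i)" for i
  proof (cases "\<sigma> i" "\<sigma> k" rule: linorder_cases)
    case less
    then have "real (\<sigma> i) + 1 \<le> y" using y unfolding k t_def by (simp; linarith)
    then have "p $ i = 1" by (simp add: p_def edge_path_def ramp_def)
    moreover have "u $ i \<le> u $ k" using antitone_rankingsD(2)[OF \<sigma>, of i k] less by force
    ultimately show ?thesis using x01[of i] by (simp add: mult_nonpos_nonpos)
  next
    case equal
    then show ?thesis using rankings_eq_iff[OF r] by simp
  next
    case greater
    then have "y \<le> real (\<sigma> i)"
      using y rankings_less[OF r, of i] unfolding k t_def by (simp add: min_def split: if_splits; linarith)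
    then have "p $ i = 0" by (simp add: p_def edge_path_def ramp_def)
    moreover have "u $ k \<le> u $ i" using antitone_rankingsD(2)[OF \<sigma>, of k i] greater by force
    ultimately show ?thesis using x01[of i] by simp
  qed
  then have "0 \<le> (\<Sum>i\<in>UNIV. (u $ i - u $ k) * (x $ i - p $ i))" by (intro sum_nonneg) auto
  also have "\<dots> = u \<bullet> x - u \<bullet> p - u $ k * (coord_sum x - coord_sum p)"
    by (simp add: inner_vec_def coord_sum_def algebra_simps sum.distrib sum_subtractf sum_distrib_left)
  also have "coord_sum p = coord_sum x"
    unfolding p_def coord_sum_edge_path[OF r y] by (simp add: y_def)
  finally show ?thesis by (simp add: p_def y_def)
qed

text \<open>Convex combinations of sections are sections, and integration is linear. The box
  hypothesis makes continuous sections integrable.\<close>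

lemma convex_fiber_polytope:
  assumes p: "linear p" and P: "convex P" and box: "p ` P = cbox a b"
  shows "convex (fiber_polytope p P)"
proof (rule convexI)
  fix x y and s t :: real
  assume x: "x \<in> fiber_polytope p P" and y: "y \<in> fiber_polytope p P"
    and st: "0 \<le> s" "0 \<le> t" "s + t = 1"
  obtain \<gamma> where \<gamma>: "x = integral (p ` P) \<gamma>" "continuous_on (p ` P) \<gamma>"
      "\<And>z. z \<in> p ` P \<Longrightarrow> \<gamma> z \<in> P \<and> p (\<gamma> z) = z"
    using x unfolding fiber_polytope_def by blast
  obtain \<delta> where \<delta>: "y = integral (p ` P) \<delta>" "continuous_on (p ` P) \<delta>"
      "\<And>z. z \<in> p ` P \<Longrightarrow> \<delta> z \<in> P \<and> p (\<delta> z) = z"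
    using y unfolding fiber_polytope_def by blast
  define \<eta> where "\<eta> z = s *\<^sub>R \<gamma> z + t *\<^sub>R \<delta> z" for z
  have "(\<gamma> has_integral x) (p ` P)" "(\<delta> has_integral y) (p ` P)"
    using \<gamma>(1,2) \<delta>(1,2) unfolding box by (auto intro: integrable_integral integrable_continuous)
  then have "(\<eta> has_integral s *\<^sub>R x + t *\<^sub>R y) (p ` P)"
    unfolding \<eta>_def by (intro has_integral_add has_integral_cmul)
  then have "s *\<^sub>R x + t *\<^sub>R y = integral (p ` P) \<eta>" by (rule integral_unique[symmetric])
  moreover have "continuous_on (p ` P) \<eta>"
    unfolding \<eta>_def by (intro continuous_intros \<gamma>(2) \<delta>(2))
  moreover have "\<eta> z \<in> P \<and> p (\<eta> z) = z" if "z \<in> p ` P" for z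
    using \<gamma>(3)[OF that] \<delta>(3)[OF that] st convexD[OF P, of "\<gamma> z" "\<delta> z" s t]
    by (simp add: \<eta>_def linear_add[OF p] linear_scale[OF p] flip: scaleR_left_distrib distrib_right)
  ultimately show "s *\<^sub>R x + t *\<^sub>R y \<in> fiber_polytope p P"
    unfolding fiber_polytope_def by blast
qed

text \<open>A point outside the hull would be separated from it by some \<open>u\<close>; but the
  edge path that is greedy for \<open>u\<close> beats any section pointwise, and its integral is one
  of the generators. Conversely each generator is the integral of the edge path with the reversed
  ranking.\<close>

lemma fiber_polytope_unit_cube:
  "fiber_polytope coord_sum unit_cube =
    convex hull ((\<lambda>\<sigma>. (\<chi> i. 1/2) + rank_vec real \<sigma>) ` (rankings :: ('n::finite \<Rightarrow> nat) set))"
    (is "?L = convex hull ?V")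
proof
  let ?N = "real CARD('n)"
  have path: "integral {0..?N} (edge_path \<sigma>) \<in> ?V" if "\<sigma> \<in> rankings" for \<sigma> :: "'n \<Rightarrow> nat"
    unfolding integral_edge_path[OF that] using rankings_reverse[OF that] by blast
  show "?L \<subseteq> convex hull ?V"
  proof
    fix x assume "x \<in> ?L"
    then obtain \<gamma> where \<gamma>: "x = integral {0..?N} \<gamma>" "continuous_on {0..?N} \<gamma>"
        "\<And>y. y \<in> {0..?N} \<Longrightarrow> \<gamma> y \<in> unit_cube \<and> coord_sum (\<gamma> y) = y"
      unfolding fiber_polytope_def coord_sum_image_unit_cube by blast
    show "x \<in> convex hull ?V"
    proof (rule ccontr)
      assume "x \<notin> convex hull ?V"
      moreover have "closed (convex hull ?V)"
        by (intro compact_imp_closed compact_convex_hull finite_imp_compact finite_imageI finite_rankings)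
      ultimately obtain u b where u: "u \<bullet> x < b" "\<And>z. z \<in> convex hull ?V \<Longrightarrow> u \<bullet> z > b"
        using separating_hyperplane_closed_point[of "convex hull ?V" x] convex_convex_hull by blast
      \<comment> \<open>Antitone in \<open>- u\<close>: coordinates that are cheap for
        \<open>u\<close> are raised first.\<close>
      obtain \<sigma> where \<sigma>: "\<sigma> \<in> antitone_rankings (\<lambda>i. - u $ i)"
        using antitone_rankings_nonempty by blast
      have int: "((\<lambda>y. u \<bullet> \<delta> y) has_integral u \<bullet> integral {0..?N} \<delta>) {0..?N}"
        if "continuous_on {0..?N} \<delta>" for \<delta>
        using has_integral_linear[OF integrable_integral[OF integrable_continuous_real[OF that]]
            bounded_linear_inner_right[of u]] by (simp add: comp_def)
      have "u \<bullet> integral {0..?N} (edge_path \<sigma>) \<le> u \<bullet> x"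
        unfolding \<gamma>(1)
      proof (rule has_integral_le[OF int int])
        show "u \<bullet> edge_path \<sigma> y \<le> u \<bullet> \<gamma> y" if "y \<in> {0..?N}" for y
          using inner_edge_path_le[OF \<sigma>, of "\<gamma> y"] \<gamma>(3)[OF that] by simp
      qed (auto intro: \<gamma>(2) continuous_on_edge_path)
      moreover have "b < u \<bullet> integral {0..?N} (edge_path \<sigma>)"
        using path[OF antitone_rankingsD(1)[OF \<sigma>]] by (intro u(2) hull_inc)
      ultimately show False using u(1) by simp
    qed
  qed
  show "convex hull ?V \<subseteq> ?L"
  proof (rule hull_minimal)
    show "convex ?L"
      by (rule convex_fiber_polytope[OF coord_sum_linear convex_unit_cube, of 0 ?N])
        (simp add: coord_sum_image_unit_cube)
    show "?V \<subseteq> ?L"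
    proof
      fix x assume "x \<in> ?V"
      then obtain \<sigma> where \<sigma>: "\<sigma> \<in> rankings" "x = (\<chi> i. 1/2) + rank_vec real \<sigma>" by blast
      define \<tau> where "\<tau> i = CARD('n) - 1 - \<sigma> i" for i
      have \<tau>: "\<tau> \<in> rankings" unfolding \<tau>_def by (rule rankings_reverse[OF \<sigma>(1)])
      have "CARD('n) - 1 - \<tau> i = \<sigma> i" for i
        using rankings_less[OF \<sigma>(1), of i] by (simp add: \<tau>_def)
      then have "x = integral {0..?N} (edge_path \<tau>)"
        unfolding integral_edge_path[OF \<tau>] \<sigma>(2) by simp
      then show "x \<in> ?L"
        unfolding fiber_polytope_def coord_sum_image_unit_cube
        using continuous_on_edge_path edge_path_in_unit_cube coord_sum_edge_path[OF \<tau>] by blast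
    qed
  qed
qed

section \<open>The character lattice\<close>

lemma is_latticeI:
  fixes b :: "'i \<Rightarrow> 'a::euclidean_space"
  assumes I: "finite I" "inj_on b I" "independent (b ` I)"
    and M: "M = {\<Sum>i\<in>I. of_int (c i) *\<^sub>R b i | c :: 'i \<Rightarrow> int. True}"
  shows "is_lattice M"
  unfolding is_lattice_def
proof (intro exI conjI)
  show "M = {\<Sum>x\<in>b ` I. of_int (c x) *\<^sub>R x | c :: 'a \<Rightarrow> int. True}"
  proof (intro equalityI subsetI)
    fix x assume "x \<in> M"
    then obtain c :: "'i \<Rightarrow> int" where "x = (\<Sum>i\<in>I. of_int (c i) *\<^sub>R b i)" unfolding M by blast
    then have "x = (\<Sum>x\<in>b ` I. of_int (c (inv_into I b x)) *\<^sub>R x)"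
      using I(2) by (simp add: sum.reindex)
    then show "x \<in> {\<Sum>x\<in>b ` I. of_int (c x) *\<^sub>R x | c :: 'a \<Rightarrow> int. True}"
      by (intro CollectI exI[of _ "\<lambda>x. c (inv_into I b x)"]) simp
  next
    fix x assume "x \<in> {\<Sum>x\<in>b ` I. of_int (c x) *\<^sub>R x | c :: 'a \<Rightarrow> int. True}"
    then obtain c :: "'a \<Rightarrow> int" where "x = (\<Sum>x\<in>b ` I. of_int (c x) *\<^sub>R x)" by blast
    then show "x \<in> M"
      unfolding M using I(2) by (intro CollectI exI[of _ "c \<circ> b"]) (simp add: sum.reindex)
  qed
qed (use I in auto)

lemma is_lattice_linear_image:
  assumes f: "linear f" "inj f" and M: "is_lattice M"
  shows "is_lattice (f ` M)"
proof -
  obtain B where B: "finite B" "independent B"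
      "M = {\<Sum>b\<in>B. of_int (c b) *\<^sub>R b | c :: 'a \<Rightarrow> int. True}"
    using M unfolding is_lattice_def by blast
  show ?thesis
  proof (rule is_latticeI)
    show "independent (f ` B)"
      using B(2) f by (intro linear_independent_injective_image) (auto intro: inj_on_subset)
    have "f (\<Sum>b\<in>B. of_int (c b) *\<^sub>R b) = (\<Sum>b\<in>B. of_int (c b) *\<^sub>R f b)" for c :: "'a \<Rightarrow> int"
      by (simp add: linear_sum[OF f(1)] linear_scale[OF f(1)])
    then show "f ` M = {\<Sum>b\<in>B. of_int (c b) *\<^sub>R f b | c :: 'a \<Rightarrow> int. True}"
      unfolding B(3) by (auto simp: image_iff; metis)
  qed (use B f in \<open>auto intro: inj_on_subset\<close>)
qed

lemma is_lattice_Ints: "is_lattice (\<int> :: real set)"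
proof (rule is_latticeI[where I = "{()}" and b = "\<lambda>_. 1"])
  show "\<int> = {\<Sum>i\<in>{()}. of_int (c i) *\<^sub>R (1::real) | c. True}"
  proof (intro equalityI subsetI)
    fix x :: real assume "x \<in> \<int>"
    then obtain z where "x = of_int z" by (auto elim: Ints_cases)
    then show "x \<in> {\<Sum>i\<in>{()}. of_int (c i) *\<^sub>R (1::real) | c. True}"
      by (intro CollectI exI[of _ "\<lambda>_. z"]) simp
  qed auto
qed auto

text \<open>The coefficients are the coordinates themselves, so one expansion gives both an integral
  basis of \<open>char_lattice\<close> and its real span.\<close>

lemma zero_sum_expand:
  fixes x :: "real ^ 'n"
  assumes "coord_sum x = 0"
  shows "x = (\<Sum>i\<in>UNIV - {i0}. x $ i *\<^sub>R (axis i 1 - axis i0 1))"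
proof -
  have "(\<Sum>i\<in>UNIV - {i0}. x $ i *\<^sub>R (axis i 1 - axis i0 1)) =
      (\<Sum>i\<in>UNIV. x $ i *\<^sub>R (axis i 1 - axis i0 1))"
    by (rule sum.mono_neutral_left) auto
  also have "\<dots> = (\<Sum>i\<in>UNIV. x $ i *\<^sub>R axis i 1) - coord_sum x *\<^sub>R axis i0 1"
    by (simp add: scaleR_diff_right sum_subtractf coord_sum_def scaleR_left.sum)
  also have "\<dots> = x"
    using assms basis_expansion[of x] by (simp add: scalar_mult_eq_scaleR)
  finally show ?thesis ..
qed

lemma coord_sum_axis [simp]: "coord_sum (axis i c) = c"
  by (simp add: coord_sum_def axis_def)

lemma is_lattice_char_lattice: "is_lattice (char_lattice :: (real ^ 'n) set)"
proof -
  fix i0 :: 'n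
  define b where "b i = axis i 1 - axis i0 (1::real)" for i
  have b: "b i $ j = (if i = j then 1 else 0)" if "j \<noteq> i0" for i j
    using that by (simp add: b_def axis_def)
  have inj: "inj_on b (UNIV - {i0})"
  proof (rule inj_onI)
    fix i j assume "i \<in> UNIV - {i0}" "j \<in> UNIV - {i0}" "b i = b j"
    then show "i = j" using b[of j i] b[of j j] by (simp split: if_splits)
  qed
  show ?thesis
  proof (rule is_latticeI[OF _ inj])
    show "independent (b ` (UNIV - {i0}))"
    proof (rule independent_if_scalars_zero)
      fix f x assume f: "(\<Sum>x\<in>b ` (UNIV - {i0}). f x *\<^sub>R x) = 0" and "x \<in> b ` (UNIV - {i0})"
      then obtain i where i: "x = b i" "i \<noteq> i0" by blast
      have "0 = (\<Sum>j\<in>UNIV - {i0}. f (b j) *\<^sub>R b j) $ i"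
        using f inj by (simp add: sum.reindex)
      also have "\<dots> = (\<Sum>j\<in>UNIV - {i0}. if j = i then f (b j) else 0)"
        by (simp add: b[OF i(2)] if_distrib cong: if_cong)
      also have "\<dots> = f x" using i by simp
      finally show "f x = 0" ..
    qed simp
    show "char_lattice = {\<Sum>i\<in>UNIV - {i0}. of_int (c i) *\<^sub>R b i | c. True}"
    proof (intro equalityI subsetI)
      fix x :: "real ^ 'n" assume x: "x \<in> char_lattice"
      then have "x = (\<Sum>i\<in>UNIV - {i0}. of_int \<lfloor>x $ i\<rfloor> *\<^sub>R b i)"
        using zero_sum_expand[of x i0] by (simp add: char_lattice_def b_def)
      then show "x \<in> {\<Sum>i\<in>UNIV - {i0}. of_int (c i) *\<^sub>R b i | c. True}"
        by (intro CollectI exI[of _ "\<lambda>i. \<lfloor>x $ i\<rfloor>"]) simp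
    next
      fix x assume "x \<in> {\<Sum>i\<in>UNIV - {i0}. of_int (c i) *\<^sub>R b i | c. True}"
      then obtain c where x: "x = (\<Sum>i\<in>UNIV - {i0}. of_int (c i) *\<^sub>R b i)" by blast
      have "b i $ j \<in> \<int>" for i j by (simp add: b_def axis_def)
      moreover have "coord_sum x = 0"
        unfolding x by (simp add: linear_sum[OF coord_sum_linear] coord_sum_simps b_def)
      ultimately show "x \<in> char_lattice"
        by (auto simp: char_lattice_def x intro!: Ints_sum Ints_mult)
    qed
  qed simp
qed

lemma span_char_lattice: "span char_lattice = (zero_sum :: (real ^ 'n) set)"
proof
  show "span char_lattice \<subseteq> (zero_sum :: (real ^ 'n) set)"
    by (rule span_minimal[OF _ subspace_zero_sum]) (auto simp: char_lattice_def zero_sum_def)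
next
  fix i0 :: 'n
  have "axis i 1 - axis i0 1 \<in> char_lattice" for i
    by (simp add: char_lattice_def coord_sum_simps) (simp add: axis_def)
  then have "(\<Sum>i\<in>UNIV - {i0}. x $ i *\<^sub>R (axis i 1 - axis i0 1)) \<in> span char_lattice" for x
    by (intro span_sum span_scale span_base)
  then show "(zero_sum :: (real ^ 'n) set) \<subseteq> span char_lattice"
    using zero_sum_expand unfolding zero_sum_def by (metis (mono_tags) mem_Collect_eq subsetI)
qed

text \<open>The functional with coefficients \<open>- real (\<sigma> i)\<close> has
  \<open>\<sigma>\<close> as its only antitone ranking, so it selects a single point. Vertices of a
  lattice polytope are lattice points, which is how integrality of the translation is
  deduced.\<close>

lemma extreme_point_permutohedron:
  fixes \<sigma> :: "'n::finite \<Rightarrow> nat"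
  assumes \<sigma>: "\<sigma> \<in> rankings"
  shows "a + rank_vec real \<sigma> extreme_point_of convex hull ((\<lambda>\<sigma>. a + rank_vec real \<sigma>) ` rankings)"
proof -
  define u :: "real ^ 'n" where "u = (\<chi> i. - real (\<sigma> i))"
  have \<sigma>': "\<sigma> \<in> antitone_rankings (($) u)"
    using \<sigma> by (simp add: antitone_rankings_def u_def)
  have "\<tau> = \<sigma>" if \<tau>: "\<tau> \<in> antitone_rankings (($) u)" for \<tau>
  proof
    fix i
    note r = antitone_rankingsD(1)[OF \<tau>]
    have "u $ inv \<sigma> (\<tau> i) = u $ inv \<tau> (\<tau> i)"
      by (rule antitone_rankings_sorted_unique[OF \<sigma>' \<tau> rankings_less[OF r]])
    moreover have "inv \<tau> (\<tau> i) = i" using r by (simp add: rankings_def bij_betw_def)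
    ultimately have "inv \<sigma> (\<tau> i) = i"
      using rankings_eq_iff[OF \<sigma>] by (simp add: u_def)
    moreover have "\<tau> i \<in> range \<sigma>"
      using \<sigma> rankings_less[OF r] by (simp add: rankings_def bij_betw_def)
    ultimately show "\<tau> i = \<sigma> i" using f_inv_into_f by metis
  qed
  then have "antitone_rankings (($) u) = {\<sigma>}" using \<sigma>' by blast
  then have "minimizers rankings (\<lambda>\<sigma>. u \<bullet> (a + rank_vec real \<sigma>)) = {\<sigma>}"
    by (simp add: minimizers_rank_vec)
  then have "{a + rank_vec real \<sigma>} face_of convex hull ((\<lambda>\<sigma>. a + rank_vec real \<sigma>) ` rankings)"
    using convex_hull_minimizers(2)[OF finite_rankings rankings_nonempty,
        of "\<lambda>\<sigma>. a + rank_vec real \<sigma>" u] by simp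
  then show ?thesis by (simp add: face_of_singleton)
qed

text \<open>All rank vectors are integral with the same coordinate sum, so a single vertex in the
  lattice decides both conditions on \<open>a\<close>. The 1/2 from the ramps is absorbed into
  \<open>a\<close>.\<close>

lemma is_chow_polytope_iff:
  fixes Q :: "(real ^ 'n) set"
  shows "is_chow_polytope Q \<longleftrightarrow>
    (\<exists>a. (\<forall>i. a $ i \<in> \<int>) \<and> coord_sum a + (\<Sum>t<CARD('n). real t) = 0 \<and>
      Q = convex hull ((\<lambda>\<sigma>. a + rank_vec real \<sigma>) ` rankings))" (is "?L \<longleftrightarrow> ?R")
proof -
  let ?h = "(\<chi> i. 1/2) :: real ^ 'n"
  have fib: "(\<lambda>x. a + x) ` fiber_polytope coord_sum {x. \<forall>i. x $ i \<in> Delta1} =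
      convex hull ((\<lambda>\<sigma>. (a + ?h) + rank_vec real \<sigma>) ` rankings)" for a
    unfolding unit_cube_def[symmetric] fiber_polytope_unit_cube convex_hull_translation[symmetric]
    by (simp add: image_image add.assoc)
  have mem: "a + rank_vec real \<sigma> \<in> char_lattice \<longleftrightarrow>
      (\<forall>i. a $ i \<in> \<int>) \<and> coord_sum a + (\<Sum>t<CARD('n). real t) = 0"
    if "\<sigma> \<in> rankings" for a :: "real ^ 'n" and \<sigma>
  proof -
    have "(a + rank_vec real \<sigma>) $ i \<in> \<int> \<longleftrightarrow> a $ i \<in> \<int>" for i
      by (simp add: rank_vec_def)
    then show ?thesis
      using coord_sum_rank_vec[OF that, of real] by (simp add: char_lattice_def coord_sum_simps)
  qed
  show ?thesis
  proof
    assume L: ?L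
    then obtain a where Q: "Q = convex hull ((\<lambda>\<sigma>. (a + ?h) + rank_vec real \<sigma>) ` rankings)"
      unfolding is_chow_polytope_def fib by blast
    obtain W where W: "W \<subseteq> char_lattice" "Q = convex hull W"
      using L unfolding is_chow_polytope_def lattice_polytope_def by blast
    obtain \<sigma> :: "'n \<Rightarrow> nat" where \<sigma>: "\<sigma> \<in> rankings" using rankings_nonempty by blast
    have "(a + ?h) + rank_vec real \<sigma> extreme_point_of Q"
      unfolding Q by (rule extreme_point_permutohedron[OF \<sigma>])
    then have "(a + ?h) + rank_vec real \<sigma> \<in> W"
      unfolding W(2) by (rule extreme_point_of_convex_hull)
    then have "(a + ?h) + rank_vec real \<sigma> \<in> char_lattice" using W(1) by blast
    note c = this[unfolded mem[OF \<sigma>]]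
    show ?R by (intro exI[of _ "a + ?h"] conjI c[THEN conjunct1] c[THEN conjunct2] Q)
  next
    assume ?R
    then obtain a where a: "\<forall>i. a $ i \<in> \<int>" "coord_sum a + (\<Sum>t<CARD('n). real t) = 0"
        and Q: "Q = convex hull ((\<lambda>\<sigma>. a + rank_vec real \<sigma>) ` rankings)" by blast
    have "lattice_polytope char_lattice Q"
      unfolding lattice_polytope_def
    proof (intro exI[of _ "(\<lambda>\<sigma>. a + rank_vec real \<sigma>) ` rankings"] conjI Q)
      show "(\<lambda>\<sigma>. a + rank_vec real \<sigma>) ` rankings \<subseteq> char_lattice"
        using mem a by blast
    qed (simp_all add: finite_rankings rankings_nonempty)
    moreover have "inner_normal_fan (span char_lattice) Q = quotient_fan"
      unfolding Q span_char_lattice by (rule inner_normal_fan_permutohedron)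
    moreover have "Q = (\<lambda>x. (a - ?h) + x) ` fiber_polytope coord_sum {x. \<forall>i. x $ i \<in> Delta1}"
      unfolding fib Q by simp
    ultimately show ?L unfolding is_chow_polytope_def by blast
  qed
qed

section \<open>Slices of the permutohedron\<close>

lemma rankingsI:
  fixes \<sigma> :: "'i::finite \<Rightarrow> nat"
  assumes "inj \<sigma>" "\<And>i. \<sigma> i < CARD('i)"
  shows "\<sigma> \<in> rankings"
proof -
  have "range \<sigma> = {..<CARD('i)}"
    using assms by (intro card_subset_eq) (auto simp: card_image)
  then show ?thesis using assms(1) by (simp add: rankings_def bij_betw_def)
qed

lemma convex_hull_Union_hull:
  "convex hull (\<Union>i\<in>I. convex hull (S i)) = convex hull (\<Union>i\<in>I. S i)"
proof
  show "convex hull (\<Union>i\<in>I. convex hull (S i)) \<subseteq> convex hull (\<Union>i\<in>I. S i)"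
    by (intro hull_minimal UN_least hull_mono UN_upper convex_convex_hull)
  show "convex hull (\<Union>i\<in>I. S i) \<subseteq> convex hull (\<Union>i\<in>I. convex hull (S i))"
    by (intro hull_mono UN_mono hull_subset order_refl)
qed

text \<open>The coface map omitting \<open>j\<close>: it enumerates the ranks left for the other
  coordinates when one coordinate has rank \<open>j\<close>.\<close>

definition skip :: "nat \<Rightarrow> nat \<Rightarrow> nat" where
  "skip j t = (if t < j then t else Suc t)"

text \<open>The two index sets are unrelated finite types, so a bijection \<open>e\<close> must
  identify the smaller one with the complement of the cutting coordinate \<open>i0\<close>.\<close>

locale coordinate_embedding =
  fixes i0 :: "'n::finite" and e :: "'k::finite \<Rightarrow> 'n"
  assumes bij: "bij_betw e UNIV (UNIV - {i0})"
begin

lemma inj_e: "inj e" and e_neq: "e k \<noteq> i0"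
  using bij by (auto simp: bij_betw_def)

lemma obtain_preimage:
  assumes "i \<noteq> i0" obtains k where "i = e k"
  using bij assms by (auto simp: bij_betw_def)

lemma card_eq: "CARD('n) = Suc (CARD('k))"
proof -
  have "CARD('k) = card (UNIV - {i0})" using bij by (rule bij_betw_same_card)
  then show ?thesis by simp
qed

lemma sum_split: "(\<Sum>i\<in>UNIV. g i) = g i0 + (\<Sum>k\<in>UNIV. g (e k))"
  for g :: "'n \<Rightarrow> 'b::comm_monoid_add"
  using sum.reindex_bij_betw[OF bij, of g] by (simp add: sum.remove[of UNIV i0])

definition embed :: "real ^ 'k \<Rightarrow> real ^ 'n" where
  "embed x = (\<chi> i. if i = i0 then 0 else x $ inv e i)"

lemma embed_i0 [simp]: "embed x $ i0 = 0" and embed_e [simp]: "embed x $ e k = x $ k"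
  by (simp_all add: embed_def e_neq inj_e)

lemma vec_eqI: "x $ i0 = y $ i0 \<Longrightarrow> (\<And>k. x $ e k = y $ e k) \<Longrightarrow> x = y" for x y :: "'b ^ 'n"
  by (metis vec_eq_iff obtain_preimage)

lemma linear_embed: "linear embed"
  by (rule linearI) (auto intro!: vec_eqI)

lemma inj_embed: "inj embed"
  by (rule injI) (metis embed_e vec_eq_iff)

lemma inner_embed: "u \<bullet> embed x = (\<Sum>k\<in>UNIV. u $ e k * x $ k)"
  by (simp add: inner_vec_def sum_split)

lemma coord_sum_embed: "coord_sum (embed x) = coord_sum x"
  by (simp add: coord_sum_def sum_split)

text \<open>The identification of the lattice of the smaller polytope with the kernel of the
  projection to coordinate \<open>i0\<close>.\<close>

lemma embed_char_lattice: "embed ` char_lattice = {x \<in> char_lattice. x $ i0 = 0}"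
proof (intro equalityI subsetI)
  fix y assume "y \<in> embed ` char_lattice"
  then obtain x where x: "y = embed x" "x \<in> char_lattice" by blast
  have "embed x $ i \<in> \<int>" for i
    using x(2) by (cases "i = i0") (auto simp: char_lattice_def elim: obtain_preimage)
  then show "y \<in> {x \<in> char_lattice. x $ i0 = 0}"
    using x by (simp add: char_lattice_def coord_sum_embed)
next
  fix y :: "real ^ 'n" assume y: "y \<in> {x \<in> char_lattice. x $ i0 = 0}"
  define x where "x = (\<chi> k. y $ e k)"
  have "y = embed x" using y by (intro vec_eqI) (simp_all add: x_def)
  moreover have "x \<in> char_lattice"
    using y coord_sum_embed[of x] by (simp add: char_lattice_def \<open>y = embed x\<close>[symmetric]) (simp add: x_def)
  ultimately show "y \<in> embed ` char_lattice" by blast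
qed

definition insert_rank :: "nat \<Rightarrow> ('k \<Rightarrow> nat) \<Rightarrow> 'n \<Rightarrow> nat" where
  "insert_rank j \<tau> i = (if i = i0 then j else skip j (\<tau> (inv e i)))"

lemma insert_rank_i0: "insert_rank j \<tau> i0 = j"
  and insert_rank_e: "insert_rank j \<tau> (e k) = skip j (\<tau> k)"
  by (simp_all add: insert_rank_def e_neq inj_e)

lemma insert_rank_in_rankings:
  assumes \<tau>: "\<tau> \<in> rankings" and j: "j \<le> CARD('k)"
  shows "insert_rank j \<tau> \<in> rankings"
proof (rule rankingsI)
  have neq: "skip j t \<noteq> j" for t by (simp add: skip_def)
  have skip_inj: "skip j s = skip j t \<longleftrightarrow> s = t" for s t by (auto simp: skip_def)
  show "inj (insert_rank j \<tau>)"
  proof (rule injI)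
    fix x y assume eq: "insert_rank j \<tau> x = insert_rank j \<tau> y"
    show "x = y"
    proof (cases "x = i0 \<or> y = i0")
      case True
      then show ?thesis using eq neq neq[symmetric] by (auto simp: insert_rank_def split: if_splits)
    next
      case False
      then obtain k l where "x = e k" "y = e l" using obtain_preimage by metis
      then show ?thesis
        using eq rankings_eq_iff[OF \<tau>] by (simp add: insert_rank_e skip_inj)
    qed
  qed
  show "insert_rank j \<tau> i < CARD('n)" for i
    using j rankings_less[OF \<tau>, of "inv e i"] by (simp add: insert_rank_def skip_def card_eq)
qed

lemma insert_rank_surj:
  assumes \<sigma>: "\<sigma> \<in> rankings"
  obtains \<tau> where "\<tau> \<in> rankings" "\<sigma> = insert_rank (\<sigma> i0) \<tau>"
proof
  \<comment> \<open>Closing the gap at \<open>\<sigma> i0\<close> inverts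
    \<open>skip\<close>.\<close>
  define \<tau> where "\<tau> k = (if \<sigma> (e k) < \<sigma> i0 then \<sigma> (e k) else \<sigma> (e k) - 1)" for k
  have neq: "\<sigma> (e k) \<noteq> \<sigma> i0" for k using rankings_eq_iff[OF \<sigma>] e_neq by simp
  have skip: "skip (\<sigma> i0) (\<tau> k) = \<sigma> (e k)" for k
    using neq[of k] by (auto simp: \<tau>_def skip_def)
  show "\<tau> \<in> rankings"
  proof (rule rankingsI)
    show "inj \<tau>"
      using rankings_eq_iff[OF \<sigma>] inj_e skip by (metis injD injI)
    show "\<tau> k < CARD('k)" for k
      using neq[of k] rankings_less[OF \<sigma>, of "e k"] rankings_less[OF \<sigma>, of i0]
      by (auto simp: \<tau>_def card_eq)
  qed
  show "\<sigma> = insert_rank (\<sigma> i0) \<tau>"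
  proof
    show "\<sigma> i = insert_rank (\<sigma> i0) \<tau> i" for i
      by (cases "i = i0") (auto simp: insert_rank_i0 insert_rank_e skip elim!: obtain_preimage)
  qed
qed

text \<open>Exhibits the slice at rank \<open>j\<close> as a translated, embedded permutohedron with
  a gap in its rank values.\<close>

lemma rank_vec_insert_rank:
  "rank_vec f (insert_rank j \<tau>) = axis i0 (f j) + embed (rank_vec (f \<circ> skip j) \<tau>)"
  by (rule vec_eqI) (simp_all add: rank_vec_def insert_rank_i0 insert_rank_e axis_def e_neq)

text \<open>The translation adds a constant, and \<open>embed\<close> restricts the functional to
  the coordinates in the range of \<open>e\<close>. The answer involves neither \<open>a\<close> nor
  \<open>f\<close>, so all increasing rank values give normally equivalent polytopes.\<close>

lemma minimizers_embed:
  assumes "\<And>s t. s < t \<Longrightarrow> t < CARD('k) \<Longrightarrow> f s < f t"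
  shows "minimizers rankings (\<lambda>\<tau>. u \<bullet> (a + embed (rank_vec f \<tau>))) = antitone_rankings (\<lambda>k. u $ e k)"
  using minimizers_rankings[of f "\<lambda>k. u $ e k"] assms
  by (simp add: minimizers_def inner_add_right inner_embed) (simp add: rank_vec_def)

lemma normally_equivalent_embed:
  assumes "\<And>s t. s < t \<Longrightarrow> t < CARD('k) \<Longrightarrow> f s < f t"
    and "\<And>s t. s < t \<Longrightarrow> t < CARD('k) \<Longrightarrow> g s < g t"
  shows "normally_equivalent zero_sum
    (convex hull ((\<lambda>\<tau>. a + embed (rank_vec f \<tau>)) ` rankings))
    (convex hull ((\<lambda>\<tau>. b + embed (rank_vec g \<tau>)) ` rankings))"
proof (rule normally_equivalent_if_same_minimizers[OF finite_rankings rankings_nonempty subspace_zero_sum])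
  fix u
  show "minimizers rankings (\<lambda>\<tau>. u \<bullet> (a + embed (rank_vec f \<tau>))) =
      minimizers rankings (\<lambda>\<tau>. u \<bullet> (b + embed (rank_vec g \<tau>)))"
    using minimizers_embed[of f] minimizers_embed[of g] assms by simp
qed (simp_all add: zero_sum_def coord_sum_simps coord_sum_embed coord_sum_rank_vec)

lemma cayley_slices:
  fixes Q :: "(real ^ 'n) set" and Q' :: "(real ^ 'k) set" and m :: nat
  assumes m: "CARD('k) = m" and Q: "is_chow_polytope Q" and Q': "is_chow_polytope Q'"
  shows "\<exists>R (c :: int) F.
    F = (\<lambda>x. of_int c + real m * x) ` Delta1 \<and>
    generalized_twisted_cayley_sum char_lattice \<int> (\<lambda>x. x $ i0) (m + 1) R Q F \<and>
    lattice_isomorphism char_lattice {x \<in> char_lattice. x $ i0 = 0} embed \<and>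
    (\<forall>i\<in>{1..m + 1}. normally_equivalent (span char_lattice) (R i) (embed ` Q')) \<and>
    (\<lambda>i. (\<lambda>x. x $ i0) ` R i) ` {1..m + 1} = (\<lambda>z. {z}) ` (F \<inter> \<int>)"
proof -
  obtain a where a: "\<And>i. a $ i \<in> \<int>" "coord_sum a + (\<Sum>t<CARD('n). real t) = 0"
    and Q: "Q = convex hull ((\<lambda>\<sigma>. a + rank_vec real \<sigma>) ` rankings)"
    using Q unfolding is_chow_polytope_iff by blast
  obtain a' where Q': "Q' = convex hull ((\<lambda>\<tau>. a' + rank_vec real \<tau>) ` rankings)"
    using Q' unfolding is_chow_polytope_iff by blast
  \<comment> \<open>The translation of \<open>Q\<close> places the slices at heights
    \<open>c, ..., c + m\<close>.\<close>
  obtain c where c: "a $ i0 = of_int c" using a(1) Ints_cases by blast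
  \<comment> \<open>Slices are numbered from 1 but ranks start at 0, hence
    \<open>i - 1\<close>.\<close>
  define V where "V i = (\<lambda>\<tau>. a + rank_vec real (insert_rank (i - 1) \<tau>)) ` rankings" for i
  define R where "R i = convex hull (V i)" for i
  define F where "F = (\<lambda>x. of_int c + real m * x) ` Delta1"
  define v where "v i = of_int c + real (i - 1)" for i :: nat
  have F: "F = {of_int c..of_int c + real m}"
  proof -
    have "m > 0" using m by (metis zero_less_card_finite)
    then show ?thesis
      unfolding F_def Delta1_eq using image_affinity_atLeastAtMost[of "real m" "of_int c" 0 1]
      by (simp add: add.commute)
  qed
  have R_embed: "R i = convex hull ((\<lambda>\<tau>. (a + axis i0 (real (i - 1))) +
      embed (rank_vec (real \<circ> skip (i - 1)) \<tau>)) ` rankings)" for i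
    by (simp add: R_def V_def rank_vec_insert_rank add.assoc)
  have mono: "(real \<circ> skip j) s < (real \<circ> skip j) t" if "s < t" for j s t
    using that by (simp add: skip_def)
  have Q'_embed: "embed ` Q' = convex hull ((\<lambda>\<tau>. embed a' + embed (rank_vec real \<tau>)) ` rankings)"
    unfolding Q' convex_hull_linear_image[OF linear_embed]
    by (simp add: image_image linear_add[OF linear_embed])
  have rk: "insert_rank (i - 1) \<tau> \<in> rankings" if "i \<in> {1..m + 1}" "\<tau> \<in> rankings" for i \<tau>
    using that m by (intro insert_rank_in_rankings) auto
  have lin: "linear (\<lambda>x :: real ^ 'n. x $ i0)" by (rule linearI) simp_all
  have "a + rank_vec real \<sigma> \<in> char_lattice" if "\<sigma> \<in> rankings" for \<sigma>
    using a coord_sum_rank_vec[OF that, of real]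
    by (simp add: char_lattice_def coord_sum_simps) (simp add: rank_vec_def)
  then have VM: "V i \<subseteq> char_lattice" if "i \<in> {1..m + 1}" for i
    using rk[OF that] unfolding V_def by blast
  have poly: "lattice_polytope char_lattice (R i)" if "i \<in> {1..m + 1}" for i
    unfolding lattice_polytope_def
  proof (intro exI conjI)
    show "finite (V i)" "V i \<noteq> {}"
      by (simp_all add: V_def finite_rankings rankings_nonempty)
  qed (use VM[OF that] in \<open>simp_all add: R_def\<close>)
  have fibre: "(\<lambda>x. x $ i0) ` R i = {v i}" for i
  proof -
    have "(\<lambda>x. x $ i0) ` V i = {v i}"
      using rankings_nonempty
      by (auto simp: V_def v_def c rank_vec_def insert_rank_i0 image_image)
    then show ?thesis
      unfolding R_def convex_hull_linear_image[OF lin] by simp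
  qed
  have hull_v: "F = convex hull (v ` {1..m + 1})"
  proof
    have "{of_int c, of_int c + real m} \<subseteq> v ` {1..m + 1}"
      by (force simp: v_def image_iff)
    then have "convex hull {of_int c, of_int c + real m} \<subseteq> convex hull (v ` {1..m + 1})"
      by (rule hull_mono)
    then show "F \<subseteq> convex hull (v ` {1..m + 1})"
      by (simp add: F segment_convex_hull[symmetric] closed_segment_eq_real_ivl)
    show "convex hull (v ` {1..m + 1}) \<subseteq> F"
      unfolding F by (rule hull_minimal) (auto simp: v_def)
  qed
  have "(\<Union>i\<in>{1..m + 1}. V i) = (\<lambda>\<sigma>. a + rank_vec real \<sigma>) ` rankings"
  proof
    show "(\<Union>i\<in>{1..m + 1}. V i) \<subseteq> (\<lambda>\<sigma>. a + rank_vec real \<sigma>) ` rankings"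
      using rk unfolding V_def by blast
    show "(\<lambda>\<sigma>. a + rank_vec real \<sigma>) ` rankings \<subseteq> (\<Union>i\<in>{1..m + 1}. V i)"
    proof (rule image_subsetI)
      fix \<sigma> :: "'n \<Rightarrow> nat" assume \<sigma>: "\<sigma> \<in> rankings"
      obtain \<tau> where \<tau>: "\<tau> \<in> rankings" "\<sigma> = insert_rank (\<sigma> i0) \<tau>"
        by (rule insert_rank_surj[OF \<sigma>])
      have "a + rank_vec real (insert_rank (\<sigma> i0) \<tau>) \<in> V (Suc (\<sigma> i0))"
        unfolding V_def using \<tau>(1) by simp
      then have "a + rank_vec real \<sigma> \<in> V (Suc (\<sigma> i0))"
        unfolding \<tau>(2)[symmetric] .
      moreover have "Suc (\<sigma> i0) \<in> {1..m + 1}"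
        using rankings_less[OF \<sigma>, of i0] m by (simp add: card_eq)
      ultimately show "a + rank_vec real \<sigma> \<in> (\<Union>i\<in>{1..m + 1}. V i)" by blast
    qed
  qed
  then have hull_R: "Q = convex hull (\<Union>i\<in>{1..m + 1}. R i)"
    unfolding R_def Q convex_hull_Union_hull by simp
  have surj: "(\<lambda>x. x $ i0) ` (char_lattice :: (real ^ 'n) set) = \<int>"
  proof (intro equalityI subsetI)
    fix z :: real assume z: "z \<in> \<int>"
    \<comment> \<open>A second coordinate balances the sum; any value of \<open>e\<close> will
      do.\<close>
    define x where "x = axis i0 z - axis (e undefined) z"
    have "x \<in> char_lattice"
      using z by (simp add: x_def char_lattice_def coord_sum_simps) (simp add: axis_def)
    moreover have "z = x $ i0" using e_neq[of undefined, symmetric] by (simp add: x_def axis_def)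
    ultimately show "z \<in> (\<lambda>x. x $ i0) ` (char_lattice :: (real ^ 'n) set)" by blast
  qed (auto simp: char_lattice_def)
  have "generalized_twisted_cayley_sum char_lattice \<int> (\<lambda>x. x $ i0) (m + 1) R Q F"
    unfolding generalized_twisted_cayley_sum_def lattice_surjection_def
  proof (intro conjI ballI)
    show "normally_equivalent (span char_lattice) (R i) (R j)" for i j
      unfolding span_char_lattice R_embed by (intro normally_equivalent_embed mono)
    show "\<exists>v. (\<forall>i\<in>{1..m + 1}. v i \<in> \<int> \<and> (\<lambda>x. x $ i0) ` R i = {v i}) \<and>
        F = convex hull (v ` {1..m + 1})"
      using fibre hull_v by (intro exI[of _ v]) (simp add: v_def)
  qed (use is_lattice_char_lattice is_lattice_Ints lin surj poly hull_R in auto)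
  moreover have "lattice_isomorphism char_lattice {x \<in> char_lattice. x $ i0 = 0} embed"
    unfolding lattice_isomorphism_def embed_char_lattice[symmetric]
    using is_lattice_char_lattice is_lattice_linear_image[OF linear_embed inj_embed] linear_embed
      inj_on_subset[OF inj_embed]
    by (auto simp: bij_betw_def)
  moreover have "\<forall>i\<in>{1..m + 1}. normally_equivalent (span char_lattice) (R i) (embed ` Q')"
    unfolding span_char_lattice R_embed Q'_embed by (intro ballI normally_equivalent_embed mono) simp_all
  moreover have "(\<lambda>i. (\<lambda>x. x $ i0) ` R i) ` {1..m + 1} = (\<lambda>z. {z}) ` (F \<inter> \<int>)"
  proof -
    have "v ` {1..m + 1} = F \<inter> \<int>"
    proof (intro equalityI subsetI)
      fix z assume z: "z \<in> F \<inter> \<int>"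
      then obtain l where l: "z = of_int l" by (auto elim: Ints_cases)
      have "c \<le> l" "l \<le> c + int m" using z unfolding F l by auto
      then have "z = v (nat (l - c) + 1)" "nat (l - c) + 1 \<in> {1..m + 1}"
        by (auto simp: v_def l)
      then show "z \<in> v ` {1..m + 1}" by blast
    qed (auto simp: F v_def)
    then show ?thesis unfolding fibre by (simp only: image_image flip: \<open>v ` {1..m + 1} = F \<inter> \<int>\<close>)
  qed
  ultimately show ?thesis
    using F_def by (intro exI[of _ R] exI[of _ c] exI[of _ F] conjI)
qed

end

theorem corollary4p4:
  fixes m :: nat
  assumes "m \<ge> 1" and "CARD('k::finite) = m" and "CARD('n::finite) = m + 1"
  shows
    "(\<exists>Q :: (real ^ 'n) set. is_chow_polytope Q) \<and>
     (\<forall>(Q :: (real ^ 'n) set) (Q' :: (real ^ 'k) set).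
        is_chow_polytope Q \<and> is_chow_polytope Q' \<longrightarrow>
        (\<exists>(\<pi> :: real ^ 'n \<Rightarrow> real) (\<iota> :: real ^ 'k \<Rightarrow> real ^ 'n)
           (R :: nat \<Rightarrow> (real ^ 'n) set) (c :: int) (F :: real set).
           F = (\<lambda>x. of_int c + real m * x) ` Delta1 \<and>
           generalized_twisted_cayley_sum char_lattice \<int> \<pi> (m + 1) R Q F \<and>
           lattice_isomorphism char_lattice {x \<in> char_lattice. \<pi> x = 0} \<iota> \<and>
           (\<forall>i\<in>{1..m + 1}. normally_equivalent (span char_lattice) (R i) (\<iota> ` Q')) \<and>
           (\<lambda>i. \<pi> ` R i) ` {1..m + 1} = (\<lambda>z. {z}) ` (F \<inter> \<int>)))"
proof (intro conjI allI impI)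
  fix i0 :: 'n
  show "\<exists>Q :: (real ^ 'n) set. is_chow_polytope Q"
  proof -
    \<comment> \<open>The ranks sum to \<open>n (n - 1) / 2\<close> with
      \<open>n = CARD('n)\<close>. Spreading the correction evenly would give half-integers for even
      \<open>n\<close>, so it is put on one coordinate.\<close>
    let ?a = "axis i0 (- (\<Sum>t<CARD('n). real t))"
    have "(\<forall>i. ?a $ i \<in> \<int>) \<and> coord_sum ?a + (\<Sum>t<CARD('n). real t) = 0"
      unfolding coord_sum_axis by (auto simp: axis_def intro!: Ints_minus Ints_sum)
    then show ?thesis unfolding is_chow_polytope_iff by blast
  qed
next
  fix Q :: "(real ^ 'n) set" and Q' :: "(real ^ 'k) set"
  assume Q: "is_chow_polytope Q \<and> is_chow_polytope Q'"
  fix i0 :: 'n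
  have "card (UNIV :: 'k set) = card (UNIV - {i0})" using assms by simp
  then obtain e :: "'k \<Rightarrow> 'n" where "bij_betw e UNIV (UNIV - {i0})"
    using finite_same_card_bij[of "UNIV :: 'k set" "UNIV - {i0}"] by auto
  then interpret coordinate_embedding i0 e by unfold_locales
  show "\<exists>(\<pi> :: real ^ 'n \<Rightarrow> real) (\<iota> :: real ^ 'k \<Rightarrow> real ^ 'n)
           (R :: nat \<Rightarrow> (real ^ 'n) set) (c :: int) (F :: real set).
           F = (\<lambda>x. of_int c + real m * x) ` Delta1 \<and>
           generalized_twisted_cayley_sum char_lattice \<int> \<pi> (m + 1) R Q F \<and>
           lattice_isomorphism char_lattice {x \<in> char_lattice. \<pi> x = 0} \<iota> \<and>
           (\<forall>i\<in>{1..m + 1}. normally_equivalent (span char_lattice) (R i) (\<iota> ` Q')) \<and>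
           (\<lambda>i. \<pi> ` R i) ` {1..m + 1} = (\<lambda>z. {z}) ` (F \<inter> \<int>)"
    by (intro exI[of _ "\<lambda>x. x $ i0"] exI[of _ embed]) (intro cayley_slices[OF assms(2)]; use Q in simp)
qed

end
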